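(* Let $\overline{B}=(B_0,B_1)$ be an interpolation couple of complex Banach spaces and let $\theta\in(0,1)$. Assume that the norm on $B_0$ is uniformly rotund. Then the norm on the complex interpolation space $B_\theta=(B_0,B_1)_\theta$ is uniformly rotund.
   Context: An interpolation couple $(B_0,B_1)$ is a pair of complex Banach spaces continuously embedded in a common Hausdorff topological vector space; $B_0+B_1$ carries the norm $\|a\|_{B_0+B_1}=\inf\{\|a_0\|_{B_0}+\|a_1\|_{B_1}: a=a_0+a_1,\ a_j\in B_j\}$. Complex interpolation space: let $S_0=\{z\in\mathbb{C}: 0<\operatorname{Re} z<1\}$ and $S=\overline{S_0}$. Let $\mathcal{F}(\overline{B})$ be the space of functions $F:S\to B_0+B_1$ that are bounded and continuous on $S$, holomorphic on $S_0$, and such that for $j\in\{0,1\}$ the map $\tau\mapsto F(j+i\tau)$ lies in $C_0(\mathbb{R},B_j)$ (continuous, vanishing at infinity), with norm $\|F\|_{\mathcal{F}(\overline{B})}=\max_{j\in\{0,1\}}\sup_{\tau\in\mathbb{R}}\|F(j+i\tau)\|_{B_j}$. For $0<\theta<1$, $B_\theta=\{F(\theta): F\in\mathcal{F}(\overline{B})\}$ with norm $\|a\|_{B_\theta}=\inf\{\|F\|_{\mathcal{F}(\overline{B})}: F(\theta)=a\}$. A norm $\|\cdot\|$ on a Banach space $X$ is uniformly rotund (UR) if $\|x_n-y_n\|\to 0$ whenever $(x_n),(y_n)$ are sequences in the unit sphere of $X$ with $\lim_{n}\|x_n+y_n\|=2$. *)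

theory Defs
  imports "HOL-Analysis.Analysis"
begin

section \<open>Complex vector spaces\<close>

class complex_vector = ab_group_add +
  fixes scaleC :: "complex \<Rightarrow> 'a \<Rightarrow> 'a"  (infixr \<open>*\<^sub>C\<close> 75)
  assumes scaleC_add_right: "c *\<^sub>C (x + y) = c *\<^sub>C x + c *\<^sub>C y"
    and scaleC_add_left: "(c + d) *\<^sub>C x = c *\<^sub>C x + d *\<^sub>C x"
    and scaleC_scaleC: "c *\<^sub>C d *\<^sub>C x = (c * d) *\<^sub>C x"
    and scaleC_one: "1 *\<^sub>C x = x"

class complex_banach = complex_vector + banach +
  assumes scaleR_scaleC: "r *\<^sub>R x = complex_of_real r *\<^sub>C x"
    and norm_scaleC: "norm (c *\<^sub>C x) = cmod c * norm x"

text \<open>Hausdorff topological vector spaces over \<open>\<complex>\<close>; joint continuity of the scalar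
  multiplication is expressed in the same form as that of addition in
  \<^class>\<open>topological_monoid_add\<close>.\<close>

class complex_t2_tvs = complex_vector + t2_space + topological_ab_group_add +
  assumes tendsto_scaleC_Pair:
    "((\<lambda>p. fst p *\<^sub>C snd p) \<longlongrightarrow> c *\<^sub>C x) (nhds c \<times>\<^sub>F nhds x)"

section \<open>Interpolation couples\<close>

text \<open>The two Banach spaces are types \<open>'a\<close>, \<open>'b\<close>, and their continuous embeddings
  \<open>\<iota>\<^sub>0\<close>, \<open>\<iota>\<^sub>1\<close> into the common space \<open>'v\<close> are kept explicit. An element of \<open>'v\<close>
  lies in \<open>B\<^sub>j\<close> if it lies in the range of \<open>\<iota>\<^sub>j\<close>.\<close>

definition continuous_embedding :: "('a::complex_banach \<Rightarrow> 'v::complex_t2_tvs) \<Rightarrow> bool" where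
  "continuous_embedding \<iota> \<longleftrightarrow>
     Vector_Spaces.linear scaleC scaleC \<iota> \<and> inj \<iota> \<and> continuous_on UNIV \<iota>"

definition interpolation_couple ::
    "('a::complex_banach \<Rightarrow> 'v::complex_t2_tvs) \<Rightarrow> ('b::complex_banach \<Rightarrow> 'v) \<Rightarrow> bool" where
  "interpolation_couple \<iota>\<^sub>0 \<iota>\<^sub>1 \<longleftrightarrow> continuous_embedding \<iota>\<^sub>0 \<and> continuous_embedding \<iota>\<^sub>1"

definition sum_space ::
    "('a::complex_banach \<Rightarrow> 'v::complex_t2_tvs) \<Rightarrow> ('b::complex_banach \<Rightarrow> 'v) \<Rightarrow> 'v set" where
  "sum_space \<iota>\<^sub>0 \<iota>\<^sub>1 = {\<iota>\<^sub>0 a\<^sub>0 + \<iota>\<^sub>1 a\<^sub>1 | a\<^sub>0 a\<^sub>1. True}"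

definition sum_norm ::
    "('a::complex_banach \<Rightarrow> 'v::complex_t2_tvs) \<Rightarrow> ('b::complex_banach \<Rightarrow> 'v) \<Rightarrow> 'v \<Rightarrow> real" where
  "sum_norm \<iota>\<^sub>0 \<iota>\<^sub>1 a = Inf {norm a\<^sub>0 + norm a\<^sub>1 | a\<^sub>0 a\<^sub>1. a = \<iota>\<^sub>0 a\<^sub>0 + \<iota>\<^sub>1 a\<^sub>1}"

section \<open>The complex interpolation space\<close>

definition open_strip :: "complex set" where
  "open_strip = {z. 0 < Re z \<and> Re z < 1}"

definition strip :: "complex set" where
  "strip = closure open_strip"

text \<open>Boundedness, continuity and complex differentiability as a map into the normed space
  \<open>B\<^sub>0 + B\<^sub>1\<close>, i.e. with respect to \<^const>\<open>sum_norm\<close> and not the topology of \<open>'v\<close>.\<close>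

definition bounded_on_strip ::
    "('a::complex_banach \<Rightarrow> 'v::complex_t2_tvs) \<Rightarrow> ('b::complex_banach \<Rightarrow> 'v) \<Rightarrow> (complex \<Rightarrow> 'v) \<Rightarrow> bool" where
  "bounded_on_strip \<iota>\<^sub>0 \<iota>\<^sub>1 F \<longleftrightarrow> (\<exists>M. \<forall>z\<in>strip. sum_norm \<iota>\<^sub>0 \<iota>\<^sub>1 (F z) \<le> M)"

definition continuous_on_strip ::
    "('a::complex_banach \<Rightarrow> 'v::complex_t2_tvs) \<Rightarrow> ('b::complex_banach \<Rightarrow> 'v) \<Rightarrow> (complex \<Rightarrow> 'v) \<Rightarrow> bool" where
  "continuous_on_strip \<iota>\<^sub>0 \<iota>\<^sub>1 F \<longleftrightarrow>
     (\<forall>z\<in>strip. ((\<lambda>w. sum_norm \<iota>\<^sub>0 \<iota>\<^sub>1 (F w - F z)) \<longlongrightarrow> 0) (at z within strip))"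

definition holomorphic_on_open_strip ::
    "('a::complex_banach \<Rightarrow> 'v::complex_t2_tvs) \<Rightarrow> ('b::complex_banach \<Rightarrow> 'v) \<Rightarrow> (complex \<Rightarrow> 'v) \<Rightarrow> bool" where
  "holomorphic_on_open_strip \<iota>\<^sub>0 \<iota>\<^sub>1 F \<longleftrightarrow>
     (\<forall>z\<in>open_strip. \<exists>D\<in>sum_space \<iota>\<^sub>0 \<iota>\<^sub>1.
        ((\<lambda>w. sum_norm \<iota>\<^sub>0 \<iota>\<^sub>1 (inverse (w - z) *\<^sub>C (F w - F z) - D)) \<longlongrightarrow> 0) (at z))"

text \<open>\<open>g \<in> C\<^sub>0(\<real>, B\<^sub>j)\<close> for a function with values in \<open>'v\<close>.\<close>

definition C0_into :: "('a::complex_banach \<Rightarrow> 'v::complex_t2_tvs) \<Rightarrow> (real \<Rightarrow> 'v) \<Rightarrow> bool" where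
  "C0_into \<iota> g \<longleftrightarrow>
     (\<exists>f. (\<forall>\<tau>. g \<tau> = \<iota> (f \<tau>)) \<and> continuous_on UNIV f \<and> (f \<longlongrightarrow> 0) at_infinity)"

text \<open>Functions on the strip are total functions whose values off the strip are irrelevant.\<close>

definition interp_functions ::
    "('a::complex_banach \<Rightarrow> 'v::complex_t2_tvs) \<Rightarrow> ('b::complex_banach \<Rightarrow> 'v) \<Rightarrow> (complex \<Rightarrow> 'v) set" where
  "interp_functions \<iota>\<^sub>0 \<iota>\<^sub>1 = {F.
     F ` strip \<subseteq> sum_space \<iota>\<^sub>0 \<iota>\<^sub>1 \<and>
     bounded_on_strip \<iota>\<^sub>0 \<iota>\<^sub>1 F \<and>
     continuous_on_strip \<iota>\<^sub>0 \<iota>\<^sub>1 F \<and>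
     holomorphic_on_open_strip \<iota>\<^sub>0 \<iota>\<^sub>1 F \<and>
     C0_into \<iota>\<^sub>0 (\<lambda>\<tau>. F (\<i> * of_real \<tau>)) \<and>
     C0_into \<iota>\<^sub>1 (\<lambda>\<tau>. F (1 + \<i> * of_real \<tau>))}"

text \<open>The norm of \<open>B\<^sub>j\<close>, transported to the range of \<open>\<iota>\<^sub>j\<close>; unspecified off the range.\<close>

definition embedded_norm :: "('a::complex_banach \<Rightarrow> 'v::complex_t2_tvs) \<Rightarrow> 'v \<Rightarrow> real" where
  "embedded_norm \<iota> v = norm (inv \<iota> v)"

definition interp_functions_norm ::
    "('a::complex_banach \<Rightarrow> 'v::complex_t2_tvs) \<Rightarrow> ('b::complex_banach \<Rightarrow> 'v) \<Rightarrow> (complex \<Rightarrow> 'v) \<Rightarrow> real" where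
  "interp_functions_norm \<iota>\<^sub>0 \<iota>\<^sub>1 F =
     max (SUP \<tau>. embedded_norm \<iota>\<^sub>0 (F (\<i> * of_real \<tau>)))
         (SUP \<tau>. embedded_norm \<iota>\<^sub>1 (F (1 + \<i> * of_real \<tau>)))"

definition interp_space ::
    "('a::complex_banach \<Rightarrow> 'v::complex_t2_tvs) \<Rightarrow> ('b::complex_banach \<Rightarrow> 'v) \<Rightarrow> real \<Rightarrow> 'v set" where
  "interp_space \<iota>\<^sub>0 \<iota>\<^sub>1 \<theta> = {F (of_real \<theta>) | F. F \<in> interp_functions \<iota>\<^sub>0 \<iota>\<^sub>1}"

definition interp_norm ::
    "('a::complex_banach \<Rightarrow> 'v::complex_t2_tvs) \<Rightarrow> ('b::complex_banach \<Rightarrow> 'v) \<Rightarrow> real \<Rightarrow> 'v \<Rightarrow> real" where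
  "interp_norm \<iota>\<^sub>0 \<iota>\<^sub>1 \<theta> a =
     Inf {interp_functions_norm \<iota>\<^sub>0 \<iota>\<^sub>1 F | F. F \<in> interp_functions \<iota>\<^sub>0 \<iota>\<^sub>1 \<and> F (of_real \<theta>) = a}"

section \<open>Uniform rotundity\<close>

definition uniformly_rotund :: "'x::ab_group_add set \<Rightarrow> ('x \<Rightarrow> real) \<Rightarrow> bool" where
  "uniformly_rotund X N \<longleftrightarrow>
     (\<forall>x y :: nat \<Rightarrow> 'x.
        (\<forall>n. x n \<in> X \<and> N (x n) = 1) \<longrightarrow> (\<forall>n. y n \<in> X \<and> N (y n) = 1) \<longrightarrow>
        (\<lambda>n. N (x n + y n)) \<longlonglongrightarrow> 2 \<longrightarrow> (\<lambda>n. N (x n - y n)) \<longlonglongrightarrow> 0)"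

end

theory Submission
  imports Defs
begin

text \<open>
  If \<open>\<parallel>F(it)\<parallel> \<le> M e\<^bsup>-\<pi>g(t)\<^esup>\<close> for a continuous \<open>g \<ge> 0\<close> and \<open>\<parallel>F(1+it)\<parallel> \<le> M\<close>, then multiplying \<open>F\<close>
  by a scalar holomorphic function whose modulus is at most about \<open>e\<^bsup>\<pi>g(t)\<^esup>\<close> at \<open>it\<close>, equal to \<open>1\<close> on
  \<open>Re z = 1\<close>, and at least \<open>exp (\<kappa> \<integral>g)\<close> at \<open>\<theta>\<close> shows \<open>\<parallel>F(\<theta>)\<parallel> \<le> M exp (-\<kappa> \<integral>g)\<close>, the integral being over \<open>[-\<theta>, \<theta>]\<close>.

  Let \<open>F\<^sub>n\<close>, \<open>G\<^sub>n\<close> nearly attain the norms of \<open>x\<^sub>n\<close>, \<open>y\<^sub>n\<close>, and put \<open>d\<^sub>n(t) = \<parallel>F\<^sub>n(it) - G\<^sub>n(it)\<parallel>\<close>. By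
  rotundity of \<open>B\<^sub>0\<close>, the norm of \<open>F\<^sub>n + G\<^sub>n\<close> at \<open>it\<close> drops below \<open>2\<close> by a fixed factor wherever
  \<open>d\<^sub>n \<ge> \<rho>\<close>, so the estimate for \<open>F\<^sub>n + G\<^sub>n\<close> with \<open>g\<close> a multiple of \<open>max(0, d\<^sub>n - \<rho>)\<close> and
  \<open>\<parallel>x\<^sub>n + y\<^sub>n\<parallel> \<rightarrow> 2\<close> force \<open>\<integral>max(0, d\<^sub>n - \<rho>) \<rightarrow> 0\<close>. The estimate for \<open>F\<^sub>n - G\<^sub>n\<close> with
  \<open>\<pi>g = ln (2 / max(d\<^sub>n, \<rho>)) \<ge> ln (2/\<rho>) - max(0, d\<^sub>n - \<rho>)/\<rho>\<close> then makes \<open>\<parallel>x\<^sub>n - y\<^sub>n\<parallel>\<close> small as \<open>\<rho> \<rightarrow> 0\<close>.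
\<close>

section \<open>Scalar multiplication and the geometry of the strip\<close>

interpretation scaleC: vector_space "scaleC :: complex \<Rightarrow> 'v::complex_vector \<Rightarrow> 'v"
  by unfold_locales (simp_all add: scaleC_add_right scaleC_add_left scaleC_scaleC scaleC_one)

text \<open>Joint continuity comes from \<open>norm_scaleC\<close> by splitting the error into
  \<open>m t *\<^sub>C (f t - x)\<close> and \<open>(m t - c) *\<^sub>C x\<close>. It keeps products
  with scalar multipliers continuous on the boundary lines.\<close>

lemma tendsto_scaleC_banach:
  fixes f :: "'c \<Rightarrow> 'a::complex_banach"
  assumes "(m \<longlongrightarrow> c) A" "(f \<longlongrightarrow> x) A"
  shows "((\<lambda>t. m t *\<^sub>C f t) \<longlongrightarrow> c *\<^sub>C x) A"
proof -
  have 1: "((\<lambda>t. cmod (m t) * norm (f t - x) + cmod (m t - c) * norm x) \<longlongrightarrow> cmod c * 0 + 0 * norm x) A"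
    using assms by (intro tendsto_intros) (simp_all add: tendsto_norm_zero_iff LIM_zero_iff)
  have "norm (m t *\<^sub>C f t - c *\<^sub>C x) \<le> cmod (m t) * norm (f t - x) + cmod (m t - c) * norm x" for t
  proof -
    have "m t *\<^sub>C f t - c *\<^sub>C x = m t *\<^sub>C (f t - x) + (m t - c) *\<^sub>C x"
      by (simp add: scaleC.scale_right_diff_distrib scaleC.scale_left_diff_distrib)
    then show ?thesis by (metis norm_triangle_ineq norm_scaleC)
  qed
  then have "((\<lambda>t. m t *\<^sub>C f t - c *\<^sub>C x) \<longlongrightarrow> 0) A"
    using 1 by (intro tendsto_0_le[where K=1, OF 1[simplified]]) (auto intro!: always_eventually order.trans[OF _ abs_ge_self])
  then show ?thesis by (simp add: LIM_zero_iff)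
qed

text \<open>Allows bounds on multipliers stated for \<open>0 \<le> Re z\<close> and
  \<open>Re z \<le> 1\<close> to be used on \<open>strip\<close>, which is given as a
  closure.\<close>

lemma strip_subset: "strip \<subseteq> {z. 0 \<le> Re z \<and> Re z \<le> 1}"
  unfolding strip_def
proof (rule closure_minimal)
  show "open_strip \<subseteq> {z. 0 \<le> Re z \<and> Re z \<le> 1}" by (auto simp: open_strip_def)
  have "{z. 0 \<le> Re z \<and> Re z \<le> 1} = {z. Re z \<ge> 0} \<inter> {z. Re z \<le> 1}" by auto
  then show "closed {z. 0 \<le> Re z \<and> Re z \<le> 1}"
    by (metis closed_Int closed_halfspace_Re_ge closed_halfspace_Re_le)
qed

lemma open_open_strip: "open open_strip"
proof -
  have "open_strip = {z. Re z > 0} \<inter> {z. Re z < 1}" by (auto simp: open_strip_def)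
  then show ?thesis by (metis open_Int open_halfspace_Re_gt open_halfspace_Re_lt)
qed

lemma open_strip_subset_strip: "open_strip \<subseteq> strip"
  by (simp add: strip_def closure_subset)

section \<open>The space of interpolating functions\<close>

locale couple =
  fixes \<iota>\<^sub>0 :: "'a::complex_banach \<Rightarrow> 'v::complex_t2_tvs"
    and \<iota>\<^sub>1 :: "'b::complex_banach \<Rightarrow> 'v"
  assumes couple: "interpolation_couple \<iota>\<^sub>0 \<iota>\<^sub>1"
begin

lemma
  shows inj0: "inj \<iota>\<^sub>0" and inj1: "inj \<iota>\<^sub>1"
    and lin0: "Vector_Spaces.linear scaleC scaleC \<iota>\<^sub>0" and lin1: "Vector_Spaces.linear scaleC scaleC \<iota>\<^sub>1"
  using couple by (auto simp: interpolation_couple_def continuous_embedding_def)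

sublocale e0: Vector_Spaces.linear scaleC scaleC \<iota>\<^sub>0 by (rule lin0)
sublocale e1: Vector_Spaces.linear scaleC scaleC \<iota>\<^sub>1 by (rule lin1)

abbreviation "X \<equiv> sum_space \<iota>\<^sub>0 \<iota>\<^sub>1"
abbreviation "S \<equiv> sum_norm \<iota>\<^sub>0 \<iota>\<^sub>1"
abbreviation "\<F> \<equiv> interp_functions \<iota>\<^sub>0 \<iota>\<^sub>1"

section \<open>The sum space and its norm\<close>

lemma sum_space_add:
  assumes "v \<in> X" "w \<in> X"
  shows "v + w \<in> X"
proof -
  obtain a b c d where "v = \<iota>\<^sub>0 a + \<iota>\<^sub>1 b" "w = \<iota>\<^sub>0 c + \<iota>\<^sub>1 d"
    using assms by (auto simp: sum_space_def)
  then have "v + w = \<iota>\<^sub>0 (a + c) + \<iota>\<^sub>1 (b + d)" by (simp add: e0.add e1.add algebra_simps)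
  then show ?thesis by (auto simp: sum_space_def)
qed

lemma sum_space_scaleC: "v \<in> X \<Longrightarrow> c *\<^sub>C v \<in> X"
  unfolding sum_space_def
  by clarsimp (metis e0.scale e1.scale scaleC_add_right)

lemma sum_space_diff: "v \<in> X \<Longrightarrow> w \<in> X \<Longrightarrow> v - w \<in> X"
  using sum_space_add[of v "(-1) *\<^sub>C w"] sum_space_scaleC[of w "-1"] by simp

lemma sum_norm_le: "S (\<iota>\<^sub>0 a + \<iota>\<^sub>1 b) \<le> norm a + norm b"
  unfolding sum_norm_def by (rule cInf_lower) (auto intro!: bdd_belowI[of _ 0])

lemma sum_norm_nonneg: "v \<in> X \<Longrightarrow> 0 \<le> S v"
  unfolding sum_norm_def sum_space_def by (rule cInf_greatest) auto

lemma sum_norm_approx: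
  assumes "v \<in> X" "e > 0"
  obtains a b where "v = \<iota>\<^sub>0 a + \<iota>\<^sub>1 b" "norm a + norm b < S v + e"
proof -
  let ?A = "{norm a + norm b | a b. v = \<iota>\<^sub>0 a + \<iota>\<^sub>1 b}"
  have "?A \<noteq> {}" using assms(1) by (auto simp: sum_space_def)
  moreover have "bdd_below ?A" by (auto intro!: bdd_belowI[of _ 0])
  ultimately have "\<exists>x\<in>?A. x < S v + e"
    using assms(2) cInf_less_iff[of ?A "S v + e"] by (simp add: sum_norm_def)
  then show ?thesis using that by blast
qed

lemma sum_norm_triangle:
  assumes "v \<in> X" "w \<in> X"
  shows "S (v + w) \<le> S v + S w"
proof (rule field_le_epsilon)
  fix e :: real assume e: "e > 0"
  obtain a b where ab: "v = \<iota>\<^sub>0 a + \<iota>\<^sub>1 b" "norm a + norm b < S v + e/2"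
    using sum_norm_approx[OF assms(1), of "e/2"] e by auto
  obtain c d where cd: "w = \<iota>\<^sub>0 c + \<iota>\<^sub>1 d" "norm c + norm d < S w + e/2"
    using sum_norm_approx[OF assms(2), of "e/2"] e by auto
  have "v + w = \<iota>\<^sub>0 (a + c) + \<iota>\<^sub>1 (b + d)"
    by (simp add: ab cd e0.add e1.add algebra_simps)
  then have "S (v + w) \<le> norm (a + c) + norm (b + d)" by (metis sum_norm_le)
  also have "\<dots> \<le> (norm a + norm c) + (norm b + norm d)" by (intro add_mono norm_triangle_ineq)
  finally show "S (v + w) \<le> S v + S w + e" using ab cd by simp
qed

lemma sum_norm_scaleC_le:
  assumes "v \<in> X"
  shows "S (c *\<^sub>C v) \<le> cmod c * S v"
proof (rule field_le_epsilon)
  fix e :: real assume e: "e > 0"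
  \<comment> \<open>The summand \<open>1\<close> keeps the denominator positive when
    \<open>c = 0\<close>.\<close>
  define e' where "e' = e / (cmod c + 1)"
  have e': "e' > 0" "cmod c * e' \<le> e"
    using e by (auto simp: e'_def field_simps add_pos_nonneg add_nonneg_pos)
  obtain a b where ab: "v = \<iota>\<^sub>0 a + \<iota>\<^sub>1 b" "norm a + norm b < S v + e'"
    using sum_norm_approx[OF assms e'(1)] by auto
  have "c *\<^sub>C v = \<iota>\<^sub>0 (c *\<^sub>C a) + \<iota>\<^sub>1 (c *\<^sub>C b)"
    by (simp add: ab e0.scale e1.scale scaleC_add_right)
  then have "S (c *\<^sub>C v) \<le> norm (c *\<^sub>C a) + norm (c *\<^sub>C b)" by (metis sum_norm_le)
  also have "\<dots> = cmod c * (norm a + norm b)" by (simp add: norm_scaleC algebra_simps)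
  also have "\<dots> \<le> cmod c * (S v + e')" using ab by (intro mult_left_mono) auto
  also have "\<dots> \<le> cmod c * S v + e" using e' by (simp add: algebra_simps)
  finally show "S (c *\<^sub>C v) \<le> cmod c * S v + e" .
qed

text \<open>A squeeze. Membership in \<open>X\<close> accompanies the bound because it makes the
  infimum run over a nonempty set, which yields the lower bound \<open>0\<close>.\<close>

lemma sum_norm_tendsto_0:
  assumes "(b \<longlongrightarrow> 0) A" "\<forall>\<^sub>F w in A. f w \<in> X \<and> S (f w) \<le> b w"
  shows "((\<lambda>w. S (f w)) \<longlongrightarrow> 0) A"
  by (rule tendsto_sandwich[OF _ _ tendsto_const assms(1)])
     (use assms(2) in \<open>auto elim!: eventually_mono simp: sum_norm_nonneg\<close>)

section \<open>Closure of the function space under sums and bounded holomorphic multipliers\<close>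

lemma interp_functions_add:
  assumes F: "F \<in> \<F>" and G: "G \<in> \<F>"
  shows "(\<lambda>z. F z + G z) \<in> \<F>"
proof -
  have FX: "F z \<in> X" and GX: "G z \<in> X" if "z \<in> strip" for z
    using F G that by (auto simp: interp_functions_def)
  have "bounded_on_strip \<iota>\<^sub>0 \<iota>\<^sub>1 (\<lambda>z. F z + G z)"
  proof -
    obtain M N where "\<forall>z\<in>strip. S (F z) \<le> M" "\<forall>z\<in>strip. S (G z) \<le> N"
      using F G by (auto simp: interp_functions_def bounded_on_strip_def)
    then have "S (F z + G z) \<le> M + N" if "z \<in> strip" for z
      using sum_norm_triangle[OF FX[OF that] GX[OF that]] that by fastforce
    then show ?thesis unfolding bounded_on_strip_def by blast
  qed
  moreover have "continuous_on_strip \<iota>\<^sub>0 \<iota>\<^sub>1 (\<lambda>z. F z + G z)"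
    unfolding continuous_on_strip_def
  proof
    fix z assume z: "z \<in> strip"
    have "((\<lambda>w. S (F w - F z) + S (G w - G z)) \<longlongrightarrow> 0 + 0) (at z within strip)"
      using F G z by (intro tendsto_add) (auto simp: interp_functions_def continuous_on_strip_def)
    then show "((\<lambda>w. S (F w + G w - (F z + G z))) \<longlongrightarrow> 0) (at z within strip)"
    proof (intro sum_norm_tendsto_0, simp, unfold eventually_at_filter, intro always_eventually allI impI)
      fix w assume w: "w \<in> strip"
      have "F w + G w - (F z + G z) = (F w - F z) + (G w - G z)" by simp
      then show "F w + G w - (F z + G z) \<in> X \<and>
          S (F w + G w - (F z + G z)) \<le> S (F w - F z) + S (G w - G z)"
        by (metis FX GX w z sum_space_add sum_space_diff sum_norm_triangle)
    qed
  qed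
  moreover have "holomorphic_on_open_strip \<iota>\<^sub>0 \<iota>\<^sub>1 (\<lambda>z. F z + G z)"
    unfolding holomorphic_on_open_strip_def
  proof
    fix z assume z: "z \<in> open_strip"
    obtain D where D: "D \<in> X" "((\<lambda>w. S (inverse (w - z) *\<^sub>C (F w - F z) - D)) \<longlongrightarrow> 0) (at z)"
      using F z by (auto simp: interp_functions_def holomorphic_on_open_strip_def)
    obtain E where E: "E \<in> X" "((\<lambda>w. S (inverse (w - z) *\<^sub>C (G w - G z) - E)) \<longlongrightarrow> 0) (at z)"
      using G z by (auto simp: interp_functions_def holomorphic_on_open_strip_def)
    have "((\<lambda>w. S (inverse (w - z) *\<^sub>C (F w + G w - (F z + G z)) - (D + E))) \<longlongrightarrow> 0) (at z)"
    proof (rule sum_norm_tendsto_0)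
      show "((\<lambda>w. S (inverse (w - z) *\<^sub>C (F w - F z) - D)
             + S (inverse (w - z) *\<^sub>C (G w - G z) - E)) \<longlongrightarrow> 0) (at z)"
        using tendsto_add[OF D(2) E(2)] by simp
      have "\<forall>\<^sub>F w in at z. w \<in> open_strip"
        using eventually_at_in_open'[OF open_open_strip z] .
      then show "\<forall>\<^sub>F w in at z. inverse (w - z) *\<^sub>C (F w + G w - (F z + G z)) - (D + E) \<in> X \<and>
          S (inverse (w - z) *\<^sub>C (F w + G w - (F z + G z)) - (D + E))
          \<le> S (inverse (w - z) *\<^sub>C (F w - F z) - D) + S (inverse (w - z) *\<^sub>C (G w - G z) - E)"
      proof (rule eventually_mono)
        fix w assume w: "w \<in> open_strip"
        have "inverse (w - z) *\<^sub>C (F w + G w - (F z + G z)) - (D + E)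
          = (inverse (w - z) *\<^sub>C (F w - F z) - D) + (inverse (w - z) *\<^sub>C (G w - G z) - E)"
          by (simp add: scaleC.scale_right_diff_distrib scaleC_add_right)
        moreover have "inverse (w - z) *\<^sub>C (F w - F z) - D \<in> X" "inverse (w - z) *\<^sub>C (G w - G z) - E \<in> X"
          using FX GX w z D E open_strip_subset_strip
          by (auto intro!: sum_space_diff sum_space_scaleC)
        ultimately show "inverse (w - z) *\<^sub>C (F w + G w - (F z + G z)) - (D + E) \<in> X \<and>
          S (inverse (w - z) *\<^sub>C (F w + G w - (F z + G z)) - (D + E))
          \<le> S (inverse (w - z) *\<^sub>C (F w - F z) - D) + S (inverse (w - z) *\<^sub>C (G w - G z) - E)"
          by (metis sum_space_add sum_norm_triangle)
      qed
    qed
    then show "\<exists>D\<in>X. ((\<lambda>w. S (inverse (w - z) *\<^sub>C (F w + G w - (F z + G z)) - D)) \<longlongrightarrow> 0) (at z)"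
      using D(1) E(1) sum_space_add by blast
  qed
  moreover have "C0_into \<iota>\<^sub>0 (\<lambda>\<tau>. F (\<i> * of_real \<tau>) + G (\<i> * of_real \<tau>))"
  proof -
    obtain f g where "\<forall>\<tau>. F (\<i> * of_real \<tau>) = \<iota>\<^sub>0 (f \<tau>)" "continuous_on UNIV f" "(f \<longlongrightarrow> 0) at_infinity"
      "\<forall>\<tau>. G (\<i> * of_real \<tau>) = \<iota>\<^sub>0 (g \<tau>)" "continuous_on UNIV g" "(g \<longlongrightarrow> 0) at_infinity"
      using F G by (auto simp: interp_functions_def C0_into_def)
    then show ?thesis
      unfolding C0_into_def
      by (intro exI[of _ "\<lambda>\<tau>. f \<tau> + g \<tau>"]) (auto simp: e0.add intro!: continuous_intros tendsto_add_zero)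
  qed
  moreover have "C0_into \<iota>\<^sub>1 (\<lambda>\<tau>. F (1 + \<i> * of_real \<tau>) + G (1 + \<i> * of_real \<tau>))"
  proof -
    obtain f g where "\<forall>\<tau>. F (1 + \<i> * of_real \<tau>) = \<iota>\<^sub>1 (f \<tau>)" "continuous_on UNIV f" "(f \<longlongrightarrow> 0) at_infinity"
      "\<forall>\<tau>. G (1 + \<i> * of_real \<tau>) = \<iota>\<^sub>1 (g \<tau>)" "continuous_on UNIV g" "(g \<longlongrightarrow> 0) at_infinity"
      using F G by (auto simp: interp_functions_def C0_into_def)
    then show ?thesis
      unfolding C0_into_def
      by (intro exI[of _ "\<lambda>\<tau>. f \<tau> + g \<tau>"]) (auto simp: e1.add intro!: continuous_intros tendsto_add_zero)
  qed
  ultimately show ?thesis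
    using FX GX sum_space_add by (auto simp: interp_functions_def)
qed

text \<open>Linearity moves the factor inside \<open>j\<close>, and boundedness of \<open>m\<close>
  preserves decay at infinity.\<close>

lemma C0_into_scaleC:
  fixes j :: "'c::complex_banach \<Rightarrow> 'v"
  assumes "C0_into j g" and j: "Vector_Spaces.linear scaleC scaleC j"
    and m: "continuous_on UNIV m" "\<And>t. cmod (m t) \<le> B"
  shows "C0_into j (\<lambda>t. m t *\<^sub>C g t)"
proof -
  interpret j: Vector_Spaces.linear scaleC scaleC j by (rule j)
  obtain f where f: "\<forall>t. g t = j (f t)" "continuous_on UNIV f" "(f \<longlongrightarrow> 0) at_infinity"
    using assms by (auto simp: C0_into_def)
  have "continuous_on UNIV (\<lambda>t. m t *\<^sub>C f t)"
    using f(2) m(1) by (auto simp: continuous_on_def intro!: tendsto_scaleC_banach)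
  moreover have "((\<lambda>t. m t *\<^sub>C f t) \<longlongrightarrow> 0) at_infinity"
  proof (rule tendsto_0_le[OF f(3), of _ B], intro always_eventually allI)
    show "norm (m t *\<^sub>C f t) \<le> norm (f t) * B" for t
      using mult_right_mono[OF m(2)[of t] norm_ge_zero[of "f t"]] by (simp add: norm_scaleC mult.commute)
  qed
  ultimately show ?thesis
    unfolding C0_into_def using f(1) by (intro exI[of _ "\<lambda>t. m t *\<^sub>C f t"]) (auto simp: j.scale)
qed

text \<open>Holomorphy on an open set around the closed strip makes \<open>m\<close> continuous up
  to both boundary lines, the bound \<open>B\<close> preserves boundedness and the
  \<open>C0_into\<close> conditions, and the product rule holds inside. Multipliers thus alter
  boundary sizes without leaving \<open>\<F>\<close>.\<close>

lemma interp_functions_scaleC: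
  assumes F: "F \<in> \<F>"
    and hol: "m holomorphic_on U" and U: "open U" "{z. 0 \<le> Re z \<and> Re z \<le> 1} \<subseteq> U"
    and bd: "\<And>z. 0 \<le> Re z \<Longrightarrow> Re z \<le> 1 \<Longrightarrow> cmod (m z) \<le> B"
  shows "(\<lambda>z. m z *\<^sub>C F z) \<in> \<F>"
proof -
  have FX: "F z \<in> X" if "z \<in> strip" for z
    using F that by (auto simp: interp_functions_def)
  have sU: "z \<in> U" if "z \<in> strip" for z using that strip_subset U by auto
  have cont: "continuous_on U m" using hol by (rule holomorphic_on_imp_continuous_on)
  have "bounded_on_strip \<iota>\<^sub>0 \<iota>\<^sub>1 (\<lambda>z. m z *\<^sub>C F z)"
  proof -
    obtain M where M: "\<forall>z\<in>strip. S (F z) \<le> M"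
      using F by (auto simp: interp_functions_def bounded_on_strip_def)
    have "S (m z *\<^sub>C F z) \<le> B * M" if z: "z \<in> strip" for z
    proof -
      have "S (m z *\<^sub>C F z) \<le> cmod (m z) * S (F z)" by (rule sum_norm_scaleC_le[OF FX[OF z]])
      also have "cmod (m z) \<le> B" using z strip_subset bd by auto
      then have "cmod (m z) * S (F z) \<le> B * M"
        using M z sum_norm_nonneg[OF FX[OF z]] order.trans[OF norm_ge_zero] by (intro mult_mono) auto
      finally show ?thesis .
    qed
    then show ?thesis unfolding bounded_on_strip_def by blast
  qed
  moreover have "continuous_on_strip \<iota>\<^sub>0 \<iota>\<^sub>1 (\<lambda>z. m z *\<^sub>C F z)"
    unfolding continuous_on_strip_def
  proof
    fix z assume z: "z \<in> strip"
    have m: "(m \<longlongrightarrow> m z) (at z within strip)"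
      using cont sU z by (metis continuous_on_def continuous_on_subset subsetI)
    have "((\<lambda>w. S (F w - F z)) \<longlongrightarrow> 0) (at z within strip)"
      using F z by (auto simp: interp_functions_def continuous_on_strip_def)
    then have "((\<lambda>w. cmod (m w) * S (F w - F z) + cmod (m w - m z) * S (F z)) \<longlongrightarrow> cmod (m z) * 0 + 0 * S (F z))
        (at z within strip)"
      using m by (intro tendsto_intros) (simp_all add: tendsto_norm_zero_iff LIM_zero_iff)
    then show "((\<lambda>w. S (m w *\<^sub>C F w - m z *\<^sub>C F z)) \<longlongrightarrow> 0) (at z within strip)"
    proof (intro sum_norm_tendsto_0, simp, unfold eventually_at_filter, intro always_eventually allI impI)
      fix w assume w: "w \<in> strip"
      let ?a = "m w *\<^sub>C (F w - F z)" and ?b = "(m w - m z) *\<^sub>C F z"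
      have eq: "m w *\<^sub>C F w - m z *\<^sub>C F z = ?a + ?b"
        by (simp add: scaleC.scale_right_diff_distrib scaleC.scale_left_diff_distrib)
      have X: "F w - F z \<in> X" "F z \<in> X" "?a \<in> X" "?b \<in> X"
        using FX w z by (auto intro!: sum_space_diff sum_space_scaleC)
      show "m w *\<^sub>C F w - m z *\<^sub>C F z \<in> X \<and>
          S (m w *\<^sub>C F w - m z *\<^sub>C F z) \<le> cmod (m w) * S (F w - F z) + cmod (m w - m z) * S (F z)"
        unfolding eq
        using sum_norm_triangle[OF X(3,4)] sum_norm_scaleC_le[OF X(1), of "m w"]
          sum_norm_scaleC_le[OF X(2), of "m w - m z"] sum_space_add[OF X(3,4)] by linarith
    qed
  qed
  moreover have "holomorphic_on_open_strip \<iota>\<^sub>0 \<iota>\<^sub>1 (\<lambda>z. m z *\<^sub>C F z)"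
    unfolding holomorphic_on_open_strip_def
  proof
    fix z assume z: "z \<in> open_strip"
    have zs: "z \<in> strip" using z open_strip_subset_strip by auto
    obtain D where D: "D \<in> X" "((\<lambda>w. S (inverse (w - z) *\<^sub>C (F w - F z) - D)) \<longlongrightarrow> 0) (at z)"
      using F z by (auto simp: interp_functions_def holomorphic_on_open_strip_def)
    obtain m' where m': "(m has_field_derivative m') (at z)"
      using hol U sU[OF zs] by (metis holomorphic_on_def field_differentiable_def at_within_open)
    have mc: "(m \<longlongrightarrow> m z) (at z)"
      using cont sU[OF zs] U(1) by (metis at_within_open continuous_on_def)
    have dq: "((\<lambda>w. (m w - m z) / (w - z)) \<longlongrightarrow> m') (at z)"
      using m' by (simp add: has_field_derivative_iff)
    \<comment> \<open>The summands tend to zero by differentiability of \<open>F\<close>, continuity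
      of \<open>m\<close> and differentiability of \<open>m\<close>; they dominate the three pieces
      of the product rule expansion \<open>eq\<close> below.\<close>
    let ?b = "\<lambda>w. cmod (m w) * S (inverse (w - z) *\<^sub>C (F w - F z) - D) + cmod (m w - m z) * S D
        + cmod ((m w - m z) / (w - z) - m') * S (F z)"
    let ?E = "m' *\<^sub>C F z + m z *\<^sub>C D"
    have "((\<lambda>w. S (inverse (w - z) *\<^sub>C (m w *\<^sub>C F w - m z *\<^sub>C F z) - ?E)) \<longlongrightarrow> 0) (at z)"
    proof (rule sum_norm_tendsto_0)
      have "(?b \<longlongrightarrow> cmod (m z) * 0 + 0 * S D + 0 * S (F z)) (at z)"
        using mc dq D(2) by (intro tendsto_intros) (simp_all add: tendsto_norm_zero_iff LIM_zero_iff)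
      then show "(?b \<longlongrightarrow> 0) (at z)" by simp
      have "\<forall>\<^sub>F w in at z. w \<in> open_strip"
        using eventually_at_in_open'[OF open_open_strip z] .
      then show "\<forall>\<^sub>F w in at z. inverse (w - z) *\<^sub>C (m w *\<^sub>C F w - m z *\<^sub>C F z) - ?E \<in> X \<and>
          S (inverse (w - z) *\<^sub>C (m w *\<^sub>C F w - m z *\<^sub>C F z) - ?E) \<le> ?b w"
      proof (rule eventually_mono)
        fix w assume w: "w \<in> open_strip"
        define q where "q = inverse (w - z) *\<^sub>C (F w - F z) - D"
        have X: "q \<in> X" "D \<in> X" "F z \<in> X"
          using FX w zs D open_strip_subset_strip
          by (auto intro!: sum_space_diff sum_space_scaleC simp: q_def)
        have eq: "inverse (w - z) *\<^sub>C (m w *\<^sub>C F w - m z *\<^sub>C F z) - ?E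
          = m w *\<^sub>C q + (m w - m z) *\<^sub>C D + ((m w - m z) / (w - z) - m') *\<^sub>C F z"
          by (simp add: q_def scaleC.scale_right_diff_distrib scaleC.scale_left_diff_distrib
              scaleC_scaleC divide_inverse mult.commute algebra_simps)
        let ?x = "m w *\<^sub>C q" and ?y = "(m w - m z) *\<^sub>C D" and ?z = "((m w - m z) / (w - z) - m') *\<^sub>C F z"
        have Y: "?x \<in> X" "?y \<in> X" "?z \<in> X" "?x + ?y \<in> X" "?x + ?y + ?z \<in> X"
          using X by (auto intro!: sum_space_add sum_space_scaleC)
        have "S (?x + ?y + ?z) \<le> ?b w"
          using sum_norm_triangle[OF Y(4,3)] sum_norm_triangle[OF Y(1,2)]
            sum_norm_scaleC_le[OF X(1), of "m w"] sum_norm_scaleC_le[OF X(2), of "m w - m z"]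
            sum_norm_scaleC_le[OF X(3), of "(m w - m z) / (w - z) - m'"]
          unfolding q_def by linarith
        then show "inverse (w - z) *\<^sub>C (m w *\<^sub>C F w - m z *\<^sub>C F z) - ?E \<in> X \<and>
          S (inverse (w - z) *\<^sub>C (m w *\<^sub>C F w - m z *\<^sub>C F z) - ?E) \<le> ?b w"
          using Y(5) unfolding eq by blast
      qed
    qed
    moreover have "?E \<in> X" using D(1) FX[OF zs] by (intro sum_space_add sum_space_scaleC)
    ultimately show "\<exists>D\<in>X. ((\<lambda>w. S (inverse (w - z) *\<^sub>C (m w *\<^sub>C F w - m z *\<^sub>C F z) - D)) \<longlongrightarrow> 0) (at z)"
      by blast
  qed
  moreover have "C0_into \<iota>\<^sub>0 (\<lambda>\<tau>. m (\<i> * of_real \<tau>) *\<^sub>C F (\<i> * of_real \<tau>))"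
    using F bd U(2)
    by (intro C0_into_scaleC[OF _ lin0, where B=B] continuous_on_compose2[OF cont])
       (auto simp: interp_functions_def intro!: continuous_intros)
  moreover have "C0_into \<iota>\<^sub>1 (\<lambda>\<tau>. m (1 + \<i> * of_real \<tau>) *\<^sub>C F (1 + \<i> * of_real \<tau>))"
    using F bd U(2)
    by (intro C0_into_scaleC[OF _ lin1, where B=B] continuous_on_compose2[OF cont])
       (auto simp: interp_functions_def intro!: continuous_intros)
  ultimately show ?thesis
    using FX sum_space_scaleC by (auto simp: interp_functions_def)
qed

lemma interp_functions_diff:
  assumes F: "F \<in> \<F>" and G: "G \<in> \<F>"
  shows "(\<lambda>z. F z - G z) \<in> \<F>"
  using interp_functions_add[OF F interp_functions_scaleC[OF G, of "\<lambda>_. -1" UNIV 1]] by simp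

section \<open>Norms of interpolating functions and of their values at \<theta>\<close>

text \<open>Outside a ball the function has norm below \<open>1\<close>, and on the compact ball
  continuity bounds it. The suprema in \<open>interp_functions_norm\<close> are therefore genuine;
  injectivity lets \<open>inv j\<close> recover the function with values in the Banach
  space.\<close>

lemma C0_into_bdd_above:
  fixes j :: "'c::complex_banach \<Rightarrow> 'v"
  assumes "C0_into j g" "inj j"
  shows "bdd_above (range (\<lambda>t. embedded_norm j (g t)))"
proof -
  obtain f where f: "\<forall>t. g t = j (f t)" "continuous_on UNIV f" "(f \<longlongrightarrow> 0) at_infinity"
    using assms by (auto simp: C0_into_def)
  obtain R where R: "\<And>t. R \<le> norm t \<Longrightarrow> norm (f t) < 1"
    using f(3)[unfolded Lim_at_infinity, rule_format, of 1] by auto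
  have "compact (f ` cball 0 R)"
    by (intro compact_continuous_image continuous_on_subset[OF f(2)]) auto
  then obtain C where C: "\<And>t. t \<in> cball 0 R \<Longrightarrow> norm (f t) \<le> C"
    using compact_imp_bounded bounded_iff by (metis imageI)
  have "norm (f t) \<le> max C 1" for t
    using R[of t] C[of t] by (cases "norm t \<le> R") (auto simp: max_def)
  then show ?thesis
    using f(1) assms(2) by (intro bdd_aboveI2[of _ _ "max C 1"]) (simp add: embedded_norm_def)
qed

lemma interp_functions_norm_ge:
  assumes F: "F \<in> \<F>"
  shows "embedded_norm \<iota>\<^sub>0 (F (\<i> * of_real t)) \<le> interp_functions_norm \<iota>\<^sub>0 \<iota>\<^sub>1 F"
    and "embedded_norm \<iota>\<^sub>1 (F (1 + \<i> * of_real t)) \<le> interp_functions_norm \<iota>\<^sub>0 \<iota>\<^sub>1 F"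
proof -
  have "C0_into \<iota>\<^sub>0 (\<lambda>\<tau>. F (\<i> * of_real \<tau>))" "C0_into \<iota>\<^sub>1 (\<lambda>\<tau>. F (1 + \<i> * of_real \<tau>))"
    using F by (auto simp: interp_functions_def)
  note b = C0_into_bdd_above[OF this(1) inj0] C0_into_bdd_above[OF this(2) inj1]
  show "embedded_norm \<iota>\<^sub>0 (F (\<i> * of_real t)) \<le> interp_functions_norm \<iota>\<^sub>0 \<iota>\<^sub>1 F"
    unfolding interp_functions_norm_def by (rule order.trans[OF cSUP_upper[OF UNIV_I b(1)] max.cobounded1])
  show "embedded_norm \<iota>\<^sub>1 (F (1 + \<i> * of_real t)) \<le> interp_functions_norm \<iota>\<^sub>0 \<iota>\<^sub>1 F"
    unfolding interp_functions_norm_def by (rule order.trans[OF cSUP_upper[OF UNIV_I b(2)] max.cobounded2])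
qed

lemma interp_functions_norm_le:
  assumes "\<And>t. embedded_norm \<iota>\<^sub>0 (F (\<i> * of_real t)) \<le> M"
    and "\<And>t. embedded_norm \<iota>\<^sub>1 (F (1 + \<i> * of_real t)) \<le> M"
  shows "interp_functions_norm \<iota>\<^sub>0 \<iota>\<^sub>1 F \<le> M"
  unfolding interp_functions_norm_def using assms by (auto intro!: cSUP_least)

lemma interp_functions_norm_nonneg: "F \<in> \<F> \<Longrightarrow> 0 \<le> interp_functions_norm \<iota>\<^sub>0 \<iota>\<^sub>1 F"
  using interp_functions_norm_ge(1)[of F 0] by (simp add: embedded_norm_def order.trans[OF norm_ge_zero])

lemma interp_norm_le:
  assumes "F \<in> \<F>" "interp_functions_norm \<iota>\<^sub>0 \<iota>\<^sub>1 F \<le> M"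
  shows "interp_norm \<iota>\<^sub>0 \<iota>\<^sub>1 \<theta> (F (of_real \<theta>)) \<le> M"
  unfolding interp_norm_def
  by (rule cInf_lower2[OF _ assms(2)])
     (use assms(1) interp_functions_norm_nonneg in \<open>auto intro!: bdd_belowI[of _ 0]\<close>)

lemma interp_norm_nonneg:
  assumes "F \<in> \<F>"
  shows "0 \<le> interp_norm \<iota>\<^sub>0 \<iota>\<^sub>1 \<theta> (F (of_real \<theta>))"
  unfolding interp_norm_def
  by (rule cInf_greatest) (use assms interp_functions_norm_nonneg in auto)

lemma interp_norm_approx:
  assumes "a \<in> interp_space \<iota>\<^sub>0 \<iota>\<^sub>1 \<theta>" "interp_norm \<iota>\<^sub>0 \<iota>\<^sub>1 \<theta> a < M"
  obtains F where "F \<in> \<F>" "F (of_real \<theta>) = a" "interp_functions_norm \<iota>\<^sub>0 \<iota>\<^sub>1 F < M"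
proof -
  let ?A = "{interp_functions_norm \<iota>\<^sub>0 \<iota>\<^sub>1 F | F. F \<in> \<F> \<and> F (of_real \<theta>) = a}"
  have "?A \<noteq> {}" using assms(1) by (auto simp: interp_space_def)
  moreover have "bdd_below ?A" using interp_functions_norm_nonneg by (auto intro!: bdd_belowI[of _ 0])
  ultimately have "\<exists>x\<in>?A. x < M"
    using assms(2) cInf_less_iff[of ?A M] by (simp add: interp_norm_def)
  then show ?thesis using that by blast
qed

end

section \<open>Scalar multipliers with prescribed boundary modulus\<close>

text \<open>Up to the factor \<open>1/\<pi>\<close>, the real part of the kernel is the Poisson kernel of the half plane
  \<open>Re z > -\<epsilon>\<close> minus its mirror image in the line \<open>Re z = 1\<close>, on which it therefore vanishes. The
  shift by \<open>\<epsilon>\<close> keeps the poles off the closed strip.\<close>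

definition kern :: "real \<Rightarrow> complex \<Rightarrow> complex" where
  "kern \<epsilon> z = inverse (z + of_real \<epsilon>) - inverse (2 + of_real \<epsilon> - z)"

lemma Re_kern:
  "Re (kern \<epsilon> z) = (Re z + \<epsilon>) / ((Re z + \<epsilon>)\<^sup>2 + (Im z)\<^sup>2)
    - (2 + \<epsilon> - Re z) / ((2 + \<epsilon> - Re z)\<^sup>2 + (Im z)\<^sup>2)"
  by (simp add: kern_def)

lemma Re_kern_le:
  assumes "\<epsilon> > 0" "0 \<le> Re z" "Re z \<le> 1"
  shows "Re (kern \<epsilon> z) \<le> (Re z + \<epsilon>) / ((Re z + \<epsilon>)\<^sup>2 + (Im z)\<^sup>2)"
  unfolding Re_kern using assms by simp

text \<open>The positive term is at most the reciprocal of \<open>Re z + \<epsilon>\<close>. Being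
  uniform over the strip, the bound makes the exponential multiplier bounded for each fixed
  \<epsilon>.\<close>

lemma Re_kern_le_inverse:
  assumes "\<epsilon> > 0" "0 \<le> Re z" "Re z \<le> 1"
  shows "Re (kern \<epsilon> z) \<le> 1 / \<epsilon>"
proof -
  let ?a = "Re z + \<epsilon>"
  have a: "?a > 0" using assms by simp
  have "Re (kern \<epsilon> z) \<le> ?a / (?a\<^sup>2 + (Im z)\<^sup>2)" by (rule Re_kern_le[OF assms])
  also have "\<dots> \<le> ?a / ?a\<^sup>2" using a by (intro divide_left_mono) (auto intro!: mult_pos_pos add_pos_nonneg)
  also have "\<dots> = 1 / ?a" using a by (simp add: power2_eq_square)
  also have "\<dots> \<le> 1 / \<epsilon>" using assms by (intro divide_left_mono) auto
  finally show ?thesis .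
qed

lemma Re_kern_eq_0: "Re z = 1 \<Longrightarrow> Re (kern \<epsilon> z) = 0"
  by (simp add: Re_kern)

text \<open>A lower bound for the kernel, independent of \<epsilon>: lower bounds
  \<open>2 * (1 - \<theta>)\<close> and \<open>2 * \<theta> * (1 - \<theta>)\<close> for the factors
  of the numerator, over the bound \<open>5 * 10\<close> for the product of the
  denominators.\<close>

definition kappa :: "real \<Rightarrow> real" where
  "kappa \<theta> = 2 * \<theta> * (1 - \<theta>)\<^sup>2 / 25"

lemma kappa_pos: "0 < \<theta> \<Longrightarrow> \<theta> < 1 \<Longrightarrow> kappa \<theta> > 0"
  by (simp add: kappa_def)

text \<open>With \<open>a = \<theta> + \<epsilon>\<close>, \<open>b = 2 + \<epsilon> - \<theta>\<close> the real part at \<open>\<theta> + it\<close> has the sign of \<open>ab - t\<^sup>2\<close>: the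
  restriction to \<open>\<bar>t\<bar> \<le> \<theta>\<close> is what makes a single mirror image sufficient.\<close>

lemma Re_kern_ge:
  assumes "0 < \<epsilon>" "\<epsilon> \<le> 1" "0 < \<theta>" "\<theta> < 1" "Re z = \<theta>" "\<bar>Im z\<bar> \<le> \<theta>"
  shows "kappa \<theta> \<le> Re (kern \<epsilon> z)"
proof -
  define a b t where "a = \<theta> + \<epsilon>" and "b = 2 + \<epsilon> - \<theta>" and "t = Im z"
  have t2: "t\<^sup>2 \<le> \<theta>\<^sup>2" using assms abs_le_square_iff[of t \<theta>] by (simp add: t_def)
  have th2: "\<theta>\<^sup>2 \<le> 1" using assms by (simp add: abs_square_le_1)
  have a: "0 < a" "a \<le> 2" and b: "0 < b" "b \<le> 3" using assms by (auto simp: a_def b_def)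
  \<comment> \<open>Dropping \<epsilon> from both factors leaves
    \<open>\<theta> * (2 - \<theta>)\<close>, and subtracting
    \<open>t\<^sup>2 \<le> \<theta>\<^sup>2\<close> then leaves at least
    \<open>2 * \<theta> * (1 - \<theta>)\<close>.\<close>
  have "\<theta> * (2 - \<theta>) \<le> a * b" unfolding a_def b_def using assms by (intro mult_mono) auto
  then have ab: "2 * \<theta> * (1 - \<theta>) \<le> a * b - t\<^sup>2" using t2 by (simp add: algebra_simps power2_eq_square)
  have a2: "a\<^sup>2 \<le> 2\<^sup>2" and b2: "b\<^sup>2 \<le> 3\<^sup>2" using power_mono[of a 2 2] power_mono[of b 3 2] a b by simp_all
  have pos: "0 < a\<^sup>2 + t\<^sup>2" "0 < b\<^sup>2 + t\<^sup>2" using a b by (auto intro!: add_pos_nonneg)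
  have den: "(a\<^sup>2 + t\<^sup>2) * (b\<^sup>2 + t\<^sup>2) \<le> 5 * 10"
    using a2 b2 t2 th2 pos by (intro mult_mono) auto
  have "kappa \<theta> = (2 * (1 - \<theta>)) * (2 * \<theta> * (1 - \<theta>)) / (5 * 10)"
    by (simp add: kappa_def power2_eq_square)
  also have "\<dots> \<le> (2 * (1 - \<theta>)) * (2 * \<theta> * (1 - \<theta>)) / ((a\<^sup>2 + t\<^sup>2) * (b\<^sup>2 + t\<^sup>2))"
    using den pos assms by (intro divide_left_mono) auto
  also have "\<dots> \<le> (b - a) * (a * b - t\<^sup>2) / ((a\<^sup>2 + t\<^sup>2) * (b\<^sup>2 + t\<^sup>2))"
    using ab pos assms by (intro divide_right_mono mult_mono) (auto simp: a_def b_def)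
  also have "\<dots> = a / (a\<^sup>2 + t\<^sup>2) - b / (b\<^sup>2 + t\<^sup>2)"
  proof -
    have "a / (a\<^sup>2 + t\<^sup>2) - b / (b\<^sup>2 + t\<^sup>2)
        = (a * (b\<^sup>2 + t\<^sup>2) - b * (a\<^sup>2 + t\<^sup>2)) / ((a\<^sup>2 + t\<^sup>2) * (b\<^sup>2 + t\<^sup>2))"
      using pos by (subst diff_frac_eq) auto
    moreover have "a * (b\<^sup>2 + t\<^sup>2) - b * (a\<^sup>2 + t\<^sup>2) = (b - a) * (a * b - t\<^sup>2)"
      by (simp add: algebra_simps power2_eq_square)
    ultimately show ?thesis by simp
  qed
  also have "\<dots> = Re (kern \<epsilon> z)" using assms(5) by (simp add: Re_kern a_def b_def t_def)
  finally show ?thesis .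
qed

text \<open>An antiderivative in \<open>s\<close> is \<open>arctan ((s - t) / \<epsilon>)\<close>,
  whose increments stay below \<open>pi\<close> whatever \<epsilon>, \<open>t\<close> and the
  interval are.\<close>

lemma poisson_kernel_integral:
  fixes \<epsilon> a b t :: real
  assumes "\<epsilon> > 0" "a \<le> b"
  shows "(\<lambda>s. \<epsilon> / (\<epsilon>\<^sup>2 + (t - s)\<^sup>2)) integrable_on {a..b}"
    and "integral {a..b} (\<lambda>s. \<epsilon> / (\<epsilon>\<^sup>2 + (t - s)\<^sup>2)) \<le> pi"
proof -
  have "((\<lambda>s. \<epsilon> / (\<epsilon>\<^sup>2 + (t - s)\<^sup>2)) has_integral
      (arctan ((b - t) / \<epsilon>) - arctan ((a - t) / \<epsilon>))) {a..b}"
  proof (rule fundamental_theorem_of_calculus[OF assms(2)])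
    fix s
    have "((\<lambda>s. arctan ((s - t) / \<epsilon>)) has_real_derivative inverse (1 + ((s - t) / \<epsilon>)\<^sup>2) * (1 / \<epsilon>)) (at s)"
      using assms(1) by (auto intro!: derivative_eq_intros)
    moreover have "inverse (1 + ((s - t) / \<epsilon>)\<^sup>2) * (1 / \<epsilon>) = \<epsilon> / (\<epsilon>\<^sup>2 + (t - s)\<^sup>2)"
    proof -
      have "\<epsilon>\<^sup>2 + (t - s)\<^sup>2 > 0" using assms(1) by (auto intro!: add_pos_nonneg)
      moreover have "1 + ((s - t) / \<epsilon>)\<^sup>2 = (\<epsilon>\<^sup>2 + (t - s)\<^sup>2) / \<epsilon>\<^sup>2"
        using assms(1) by (simp add: field_simps power2_commute[of s t])
      ultimately show ?thesis using assms(1) by (simp add: power2_eq_square)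
    qed
    ultimately show "((\<lambda>s. arctan ((s - t) / \<epsilon>)) has_vector_derivative \<epsilon> / (\<epsilon>\<^sup>2 + (t - s)\<^sup>2)) (at s within {a..b})"
      by (metis has_real_derivative_iff_has_vector_derivative has_field_derivative_at_within)
  qed
  then show "(\<lambda>s. \<epsilon> / (\<epsilon>\<^sup>2 + (t - s)\<^sup>2)) integrable_on {a..b}"
    "integral {a..b} (\<lambda>s. \<epsilon> / (\<epsilon>\<^sup>2 + (t - s)\<^sup>2)) \<le> pi"
    using arctan_bounded[of "(b - t) / \<epsilon>"] arctan_bounded[of "(a - t) / \<epsilon>"]
    by (auto simp: integrable_on_def integral_unique)
qed

lemma poisson_kernel_mult_integrable:
  fixes g :: "real \<Rightarrow> real"
  assumes "continuous_on UNIV g" "\<epsilon> > 0"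
  shows "(\<lambda>s. g s * (\<epsilon> / (\<epsilon>\<^sup>2 + (t - s)\<^sup>2))) integrable_on {a..b}"
  using assms(2)
  by (intro integrable_continuous_interval continuous_intros continuous_on_subset[OF assms(1)]) auto

text \<open>The kernel is split at distance \<delta> from \<open>t\<close>. Nearby, uniform
  continuity replaces \<open>g s\<close> by \<open>g t\<close> and the mass is at most
  \<open>pi\<close>; farther away the kernel is at most
  \<open>\<epsilon> / \<delta>\<^sup>2\<close>. The bound is one-sided because the cutoff at
  \<open>-\<theta>\<close> and \<open>\<theta>\<close> discards mass, and it is uniform in all real
  \<open>t\<close>.\<close>

lemma poisson_approx:
  fixes g :: "real \<Rightarrow> real"
  assumes g: "continuous_on UNIV g" "\<And>t. 0 \<le> g t" and "\<theta> > 0" "\<eta> > 0"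
  obtains \<epsilon> where "0 < \<epsilon>" "\<epsilon> \<le> 1"
    "\<And>t. integral {-\<theta>..\<theta>} (\<lambda>s. g s * (\<epsilon> / (\<epsilon>\<^sup>2 + (t - s)\<^sup>2))) \<le> pi * g t + \<eta>"
proof -
  \<comment> \<open>\<open>pi * \<eta>'\<close> is half of the permitted error \<eta>; the far part
    gets the other half.\<close>
  define \<eta>' where "\<eta>' = \<eta> / (2 * pi)"
  have \<eta>': "\<eta>' > 0" using assms by (simp add: \<eta>'_def)
  \<comment> \<open>The margin \<open>1\<close>, together with \<open>\<delta> \<le> 1\<close>,
    keeps inside this interval every \<open>t\<close> within \<delta> of a point of
    \<open>{-\<theta>..\<theta>}\<close>.\<close>
  have "uniformly_continuous_on {-\<theta>-1..\<theta>+1} g"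
    by (intro compact_uniformly_continuous continuous_on_subset[OF g(1)]) auto
  then obtain \<delta>0 where \<delta>0: "\<delta>0 > 0"
    "\<And>s t. s \<in> {-\<theta>-1..\<theta>+1} \<Longrightarrow> t \<in> {-\<theta>-1..\<theta>+1} \<Longrightarrow> dist t s < \<delta>0 \<Longrightarrow> dist (g t) (g s) < \<eta>'"
    using \<eta>' unfolding uniformly_continuous_on_def by metis
  define \<delta> where "\<delta> = min \<delta>0 1"
  have \<delta>: "\<delta> > 0" using \<delta>0 by (simp add: \<delta>_def)
  have "compact (g ` {-\<theta>..\<theta>})"
    by (intro compact_continuous_image continuous_on_subset[OF g(1)]) auto
  then obtain B0 where B0: "\<And>t. t \<in> {-\<theta>..\<theta>} \<Longrightarrow> norm (g t) \<le> B0"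
    using compact_imp_bounded bounded_iff by (metis imageI)
  define B where "B = max B0 1"
  have B: "B > 0" "\<And>t. t \<in> {-\<theta>..\<theta>} \<Longrightarrow> g t \<le> B" using B0 by (fastforce simp: B_def)+
  \<comment> \<open>Makes the far part, at most
    \<open>2 * \<theta> * (B * (\<epsilon> / \<delta>\<^sup>2))\<close>, no larger than
    \<open>\<eta> / 2\<close>; the cap \<open>1\<close> is the range in which
    \<open>Re_kern_ge\<close> applies.\<close>
  define \<epsilon> where "\<epsilon> = min 1 (\<eta> * \<delta>\<^sup>2 / (4 * \<theta> * B))"
  have \<epsilon>: "\<epsilon> > 0" "\<epsilon> \<le> 1" using assms \<delta> B by (auto simp: \<epsilon>_def)
  have "\<epsilon> \<le> \<eta> * \<delta>\<^sup>2 / (4 * \<theta> * B)" by (simp add: \<epsilon>_def)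
  then have small: "2 * \<theta> * (B * (\<epsilon> / \<delta>\<^sup>2)) \<le> \<eta> / 2"
    using assms \<delta> B by (simp add: field_simps)
  have "integral {-\<theta>..\<theta>} (\<lambda>s. g s * (\<epsilon> / (\<epsilon>\<^sup>2 + (t - s)\<^sup>2))) \<le> pi * g t + \<eta>" for t
  proof -
    let ?p = "\<lambda>s. \<epsilon> / (\<epsilon>\<^sup>2 + (t - s)\<^sup>2)"
    have den: "\<epsilon>\<^sup>2 + (t - s)\<^sup>2 > 0" for s using \<epsilon> by (auto intro!: add_pos_nonneg)
    have p0: "?p s \<ge> 0" for s using \<epsilon> den[of s] by simp
    \<comment> \<open>One majorant serves both cases, since its summands are nonnegative and each
      dominates in one of them. The interval of integration need not be split.\<close>
    have int: "(\<lambda>s. (g t + \<eta>') * ?p s + B * (\<epsilon> / \<delta>\<^sup>2)) integrable_on {-\<theta>..\<theta>}"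
      using assms(3) by (intro integrable_add integrable_on_mult_right poisson_kernel_integral(1)[OF \<epsilon>(1)]) auto
    have "integral {-\<theta>..\<theta>} (\<lambda>s. g s * ?p s) \<le> integral {-\<theta>..\<theta>} (\<lambda>s. (g t + \<eta>') * ?p s + B * (\<epsilon> / \<delta>\<^sup>2))"
    proof (rule integral_le[OF _ int])
      show "(\<lambda>s. g s * ?p s) integrable_on {-\<theta>..\<theta>}"
        by (rule poisson_kernel_mult_integrable[OF g(1) \<epsilon>(1)])
    next
      fix s assume s: "s \<in> {-\<theta>..\<theta>}"
      show "g s * ?p s \<le> (g t + \<eta>') * ?p s + B * (\<epsilon> / \<delta>\<^sup>2)"
      proof (cases "\<bar>t - s\<bar> < \<delta>")
        case True
        then have "dist (g t) (g s) < \<eta>'" using s by (intro \<delta>0) (auto simp: \<delta>_def dist_real_def)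
        then have "g s \<le> g t + \<eta>'" by (auto simp: dist_real_def)
        then have "g s * ?p s \<le> (g t + \<eta>') * ?p s" using p0 by (intro mult_right_mono) auto
        then show ?thesis using B \<epsilon> \<delta> by (simp add: add_increasing2)
      next
        case False
        then have "\<delta>\<^sup>2 \<le> (t - s)\<^sup>2" using \<delta> abs_le_square_iff[of \<delta> "t - s"] by simp
        then have "?p s \<le> \<epsilon> / \<delta>\<^sup>2"
          using \<epsilon> \<delta> den by (intro divide_left_mono) (auto intro: add_increasing)
        then have "g s * ?p s \<le> B * (\<epsilon> / \<delta>\<^sup>2)" using B s p0 g(2) by (intro mult_mono) auto
        moreover have "0 \<le> (g t + \<eta>') * ?p s" using g(2)[of t] \<eta>' p0[of s] by (intro mult_nonneg_nonneg) auto
        ultimately show ?thesis by linarith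
      qed
    qed
    also have "\<dots> = (g t + \<eta>') * integral {-\<theta>..\<theta>} ?p + 2 * \<theta> * (B * (\<epsilon> / \<delta>\<^sup>2))"
    proof (rule integral_unique)
      have "(?p has_integral integral {-\<theta>..\<theta>} ?p) {-\<theta>..\<theta>}"
        using assms(3) by (intro integrable_integral poisson_kernel_integral(1)[OF \<epsilon>(1)]) auto
      then have "((\<lambda>s. (g t + \<eta>') * ?p s + B * (\<epsilon> / \<delta>\<^sup>2)) has_integral
          (g t + \<eta>') * integral {-\<theta>..\<theta>} ?p + measure lborel {-\<theta>..\<theta>} *\<^sub>R (B * (\<epsilon> / \<delta>\<^sup>2))) {-\<theta>..\<theta>}"
        by (intro has_integral_add has_integral_mult_right has_integral_const_real)
      moreover have "measure lborel {-\<theta>..\<theta>} *\<^sub>R (B * (\<epsilon> / \<delta>\<^sup>2)) = 2 * \<theta> * (B * (\<epsilon> / \<delta>\<^sup>2))"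
        using assms(3) by simp
      ultimately show "((\<lambda>s. (g t + \<eta>') * ?p s + B * (\<epsilon> / \<delta>\<^sup>2)) has_integral
          (g t + \<eta>') * integral {-\<theta>..\<theta>} ?p + 2 * \<theta> * (B * (\<epsilon> / \<delta>\<^sup>2))) {-\<theta>..\<theta>}"
        by metis
    qed
    also have "\<dots> \<le> (g t + \<eta>') * pi + \<eta> / 2"
      using poisson_kernel_integral(2)[OF \<epsilon>(1), of "-\<theta>" \<theta> t] assms(3) g(2)[of t] \<eta>' small
      by (intro add_mono mult_left_mono) auto
    also have "\<dots> = pi * g t + \<eta>" by (simp add: \<eta>'_def field_simps)
    finally show ?thesis .
  qed
  then show ?thesis using that \<epsilon> by blast
qed

text \<open>Its exponential is an outer function: the real part is \<open>pi\<close> times a Poisson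
  integral of \<open>g\<close> cut off to \<open>{-\<theta>..\<theta>}\<close>, less the mirror
  image, so the modulus at \<open>\<i> * t\<close> is at most about
  \<open>exp (pi * g t)\<close>.\<close>

definition outer_exponent :: "real \<Rightarrow> (real \<Rightarrow> real) \<Rightarrow> real \<Rightarrow> complex \<Rightarrow> complex" where
  "outer_exponent \<theta> g \<epsilon> z = integral {-\<theta>..\<theta>} (\<lambda>s. of_real (g s) * kern \<epsilon> (z - \<i> * of_real s))"

lemma open_convex_widened_strip:
  "open {z. -\<epsilon> < Re z \<and> Re z < 2 + \<epsilon>}" "convex {z. -\<epsilon> < Re z \<and> Re z < 2 + \<epsilon>}"
proof -
  have "{z. -\<epsilon> < Re z \<and> Re z < 2 + \<epsilon>} = {z. Re z > -\<epsilon>} \<inter> {z. Re z < 2 + \<epsilon>}" by auto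
  then show "open {z. -\<epsilon> < Re z \<and> Re z < 2 + \<epsilon>}" "convex {z. -\<epsilon> < Re z \<and> Re z < 2 + \<epsilon>}"
    by (metis open_Int open_halfspace_Re_gt open_halfspace_Re_lt,
        metis convex_Int convex_halfspace_Re_gt convex_halfspace_Re_lt)
qed

text \<open>Subtracting \<open>\<i> * of_real s\<close> leaves the real part unchanged, so both
  denominators have positive real part.\<close>

lemma kern_denominators:
  assumes "-\<epsilon> < Re z" "Re z < 2 + \<epsilon>"
  shows "z - \<i> * of_real s + of_real \<epsilon> \<noteq> 0" "2 + of_real \<epsilon> - (z - \<i> * of_real s) \<noteq> 0"
  using assms by (auto simp: complex_eq_iff)

lemma continuous_on_kern:
  assumes "continuous_on UNIV g" "-\<epsilon> < Re z" "Re z < 2 + \<epsilon>"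
  shows "continuous_on A (\<lambda>s. complex_of_real (g s) * kern \<epsilon> (z - \<i> * of_real s))"
  unfolding kern_def using kern_denominators[OF assms(2,3)]
  by (intro continuous_intros continuous_on_subset[OF assms(1)]) auto

text \<open>Differentiation under the integral sign: the widened strip is convex and avoids the
  poles of all translated kernels, so the differentiated integrand is jointly continuous
  there.\<close>

lemma holomorphic_outer_exponent:
  assumes g: "continuous_on UNIV g"
  shows "outer_exponent \<theta> g \<epsilon> holomorphic_on {z. -\<epsilon> < Re z \<and> Re z < 2 + \<epsilon>}" (is "_ holomorphic_on ?U")
  unfolding holomorphic_on_def
proof
  fix z0 assume z0: "z0 \<in> ?U"
  let ?f = "\<lambda>z s. complex_of_real (g s) * kern \<epsilon> (z - \<i> * of_real s)"
  let ?f' = "\<lambda>z s. complex_of_real (g s) * (- ((inverse (z - \<i> * of_real s + of_real \<epsilon>))\<^sup>2)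
     - (inverse (2 + of_real \<epsilon> - (z - \<i> * of_real s)))\<^sup>2)"
  have "((\<lambda>z. integral (cbox (-\<theta>) \<theta>) (?f z)) has_field_derivative integral (cbox (-\<theta>) \<theta>) (?f' z0)) (at z0 within ?U)"
  proof (rule leibniz_rule_field_derivative[OF _ _ _ z0 open_convex_widened_strip(2)])
    fix z s assume "z \<in> ?U"
    then show "((\<lambda>z. ?f z s) has_field_derivative ?f' z s) (at z within ?U)"
      unfolding kern_def using kern_denominators[of \<epsilon> z s]
      by (auto intro!: derivative_eq_intros simp: power2_eq_square algebra_simps)
  next
    fix z assume "z \<in> ?U"
    then show "?f z integrable_on cbox (-\<theta>) \<theta>"
      by (intro integrable_continuous continuous_on_kern[OF g]) auto
  next
    have "continuous_on (?U \<times> cbox (-\<theta>) \<theta>) (\<lambda>x. g (snd x))"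
      by (rule continuous_on_compose2[OF g]) (auto intro!: continuous_intros)
    then show "continuous_on (?U \<times> cbox (-\<theta>) \<theta>) (\<lambda>(z, s). ?f' z s)"
      unfolding split_beta using kern_denominators[of \<epsilon>]
      by (intro continuous_intros) auto
  qed
  then show "outer_exponent \<theta> g \<epsilon> field_differentiable at z0 within ?U"
    unfolding field_differentiable_def outer_exponent_def by auto
qed

text \<open>\<open>Re\<close> is bounded linear and commutes with the integral; as \<open>g\<close>
  is real, it falls on the kernel alone.\<close>

lemma Re_outer_exponent:
  assumes g: "continuous_on UNIV g" and z: "-\<epsilon> < Re z" "Re z < 2 + \<epsilon>"
  shows "Re (outer_exponent \<theta> g \<epsilon> z) = integral {-\<theta>..\<theta>} (\<lambda>s. g s * Re (kern \<epsilon> (z - \<i> * of_real s)))"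
    and "(\<lambda>s. g s * Re (kern \<epsilon> (z - \<i> * of_real s))) integrable_on {-\<theta>..\<theta>}"
proof -
  have int: "(\<lambda>s. complex_of_real (g s) * kern \<epsilon> (z - \<i> * of_real s)) integrable_on {-\<theta>..\<theta>}"
    by (intro integrable_continuous_interval continuous_on_kern[OF g z])
  show "Re (outer_exponent \<theta> g \<epsilon> z) = integral {-\<theta>..\<theta>} (\<lambda>s. g s * Re (kern \<epsilon> (z - \<i> * of_real s)))"
    using integral_linear[OF int bounded_linear_Re] by (simp add: outer_exponent_def o_def)
  show "(\<lambda>s. g s * Re (kern \<epsilon> (z - \<i> * of_real s))) integrable_on {-\<theta>..\<theta>}"
    using integrable_linear[OF int bounded_linear_Re] by (simp add: o_def)
qed

section \<open>Uniform rotundity\<close>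

text \<open>Counterexamples for \<delta> tending to zero lie in the unit ball, whereas
  \<open>uniformly_rotund\<close> speaks of the unit sphere. A sum of norm near \<open>2\<close>
  forces both norms near \<open>1\<close>, so normalising moves the vectors little and yields
  sequences that contradict rotundity.\<close>

lemma uniformly_rotund_modulus:
  fixes \<rho> :: real
  assumes UR: "uniformly_rotund (UNIV :: 'a::complex_banach set) norm" and "\<rho> > 0"
  obtains \<delta> where "0 < \<delta>" "\<And>a b :: 'a. norm a \<le> 1 \<Longrightarrow> norm b \<le> 1 \<Longrightarrow> \<rho> \<le> norm (a - b) \<Longrightarrow> norm (a + b) \<le> 2 - \<delta>"
proof (rule ccontr)
  assume no: "\<not> thesis"
  \<comment> \<open>Starting at \<open>1 / 2\<close> keeps \<open>e n < 1\<close>, so the vectors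
    found below are nonzero and \<open>sgn\<close> normalises them.\<close>
  define e where "e n = inverse (real (Suc (Suc n)))" for n
  have "\<exists>a b :: 'a. norm a \<le> 1 \<and> norm b \<le> 1 \<and> \<rho> \<le> norm (a - b) \<and> \<not> norm (a + b) \<le> 2 - e n" for n
    using no that[of "e n"] by (auto simp: e_def)
  then obtain a b :: "nat \<Rightarrow> 'a" where ab: "\<And>n. norm (a n) \<le> 1" "\<And>n. norm (b n) \<le> 1"
    "\<And>n. \<rho> \<le> norm (a n - b n)" "\<And>n. 2 - e n < norm (a n + b n)"
    by (metis not_le)
  have e: "e \<longlonglongrightarrow> 0" unfolding e_def by (rule LIMSEQ_Suc[OF LIMSEQ_inverse_real_of_nat])
  have e1: "e n < 1" for n by (simp add: e_def field_simps)
  have na: "1 - e n < norm (a n)" and nb: "1 - e n < norm (b n)" for n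
    using norm_triangle_ineq[of "a n" "b n"] ab[of n] by linarith+
  have sgn: "norm (sgn v) = 1" "norm (sgn v - v) \<le> \<epsilon>" if "1 - \<epsilon> < norm v" "norm v \<le> 1" "\<epsilon> < 1" for v :: 'a and \<epsilon>
  proof -
    have v: "v \<noteq> 0" using that by auto
    then show "norm (sgn v) = 1" by (simp add: norm_sgn)
    have "norm v *\<^sub>R sgn v = v" using v by (simp add: sgn_div_norm)
    then have "sgn v - v = (1 - norm v) *\<^sub>R sgn v" by (simp add: scaleR_left_diff_distrib)
    then have "norm (sgn v - v) = 1 - norm v" using v that by (simp add: norm_sgn)
    then show "norm (sgn v - v) \<le> \<epsilon>" using that by simp
  qed
  let ?x = "\<lambda>n. sgn (a n)" and ?y = "\<lambda>n. sgn (b n)"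
  have x: "norm (?x n) = 1" "norm (?x n - a n) \<le> e n" and y: "norm (?y n) = 1" "norm (?y n - b n) \<le> e n" for n
    using sgn[OF na ab(1) e1] sgn[OF nb ab(2) e1] by auto
  \<comment> \<open>One \<open>e n\<close> is lost in the choice of the pair, two in the
    normalisations.\<close>
  have lower: "2 - 3 * e n \<le> norm (?x n + ?y n)" for n
  proof -
    have "norm (a n + b n) \<le> norm (?x n + ?y n) + norm (?x n - a n) + norm (?y n - b n)"
      using norm_triangle_ineq4[of "?x n + ?y n - (?x n - a n)" "?y n - b n"]
        norm_triangle_ineq4[of "?x n + ?y n" "?x n - a n"] by (simp add: algebra_simps)
    then show ?thesis using ab(4)[of n] x(2)[of n] y(2)[of n] by linarith
  qed
  have upper: "norm (?x n + ?y n) \<le> 2" for n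
    using norm_triangle_ineq[of "?x n" "?y n"] x(1)[of n] y(1)[of n] by simp
  have lim: "(\<lambda>n. 2 - 3 * e n) \<longlonglongrightarrow> 2"
    using tendsto_diff[OF tendsto_const tendsto_mult_left[OF e, of 3], of 2] by simp
  have "(\<lambda>n. norm (?x n + ?y n)) \<longlonglongrightarrow> 2"
    by (rule tendsto_sandwich[OF _ _ lim tendsto_const]) (simp_all add: lower upper)
  then have "(\<lambda>n. norm (?x n - ?y n)) \<longlonglongrightarrow> 0"
    using UR[unfolded uniformly_rotund_def, rule_format, of ?x ?y] x(1) y(1) by simp
  then have "(\<lambda>n. norm (?x n - ?y n) + 2 * e n) \<longlonglongrightarrow> 0"
    by (rule tendsto_add_zero[OF _ tendsto_mult_right_zero[OF e]])
  moreover have "\<rho> \<le> norm (?x n - ?y n) + 2 * e n" for n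
  proof -
    have "norm (a n - b n) \<le> norm (?x n - ?y n) + norm (?x n - a n) + norm (?y n - b n)"
      using norm_triangle_ineq[of "?x n - ?y n - (?x n - a n)" "?y n - b n"]
        norm_triangle_ineq4[of "?x n - ?y n" "?x n - a n"] by (simp add: algebra_simps)
    then show ?thesis using ab(3)[of n] x(2)[of n] y(2)[of n] by linarith
  qed
  ultimately have "\<rho> \<le> 0" by (meson LIMSEQ_le_const)
  then show False using assms(2) by simp
qed

section \<open>Decay of the norm at \<theta> from decay on the line \<open>Re z = 0\<close>\<close>

context couple
begin

lemma embedded_norm0: "embedded_norm \<iota>\<^sub>0 (\<iota>\<^sub>0 a) = norm a"
  and embedded_norm1: "embedded_norm \<iota>\<^sub>1 (\<iota>\<^sub>1 b) = norm b"
  using inj0 inj1 by (simp_all add: embedded_norm_def)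

lemma embedded_norm_scaleC0: "embedded_norm \<iota>\<^sub>0 (c *\<^sub>C \<iota>\<^sub>0 a) = cmod c * norm a"
  and embedded_norm_scaleC1: "embedded_norm \<iota>\<^sub>1 (c *\<^sub>C \<iota>\<^sub>1 b) = cmod c * norm b"
  by (metis e0.scale embedded_norm0 norm_scaleC) (metis e1.scale embedded_norm1 norm_scaleC)

lemma interp_functions_boundary:
  assumes "F \<in> \<F>"
  obtains f0 f1 where "\<And>t. F (\<i> * of_real t) = \<iota>\<^sub>0 (f0 t)" "continuous_on UNIV f0"
    "\<And>t. F (1 + \<i> * of_real t) = \<iota>\<^sub>1 (f1 t)"
  using assms unfolding interp_functions_def C0_into_def by blast

text \<open>The multiplier \<open>m\<close> is normalised to \<open>1\<close> at \<theta>, so the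
  product is a competitor for the same element. On \<open>Re z = 0\<close> its growth
  \<open>exp (pi * g t)\<close> is cancelled by the assumed decay of \<open>F\<close>, and on both
  lines the normalisation contributes the decaying exponential, up to
  \<open>exp \<eta>\<close>.\<close>

lemma interp_norm_exp_le:
  assumes F: "F \<in> \<F>" and \<theta>: "0 < \<theta>" "\<theta> < 1" and M: "M \<ge> 0"
    and g: "continuous_on UNIV g" "\<And>t. 0 \<le> g t"
    and F0: "\<And>t. embedded_norm \<iota>\<^sub>0 (F (\<i> * of_real t)) \<le> M * exp (- pi * g t)"
    and F1: "\<And>t. embedded_norm \<iota>\<^sub>1 (F (1 + \<i> * of_real t)) \<le> M"
  shows "interp_norm \<iota>\<^sub>0 \<iota>\<^sub>1 \<theta> (F (of_real \<theta>)) \<le> M * exp (- kappa \<theta> * integral {-\<theta>..\<theta>} g)"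
proof -
  let ?I = "integral {-\<theta>..\<theta>} g"
  have gint: "g integrable_on {-\<theta>..\<theta>}"
    by (intro integrable_continuous_interval continuous_on_subset[OF g(1)]) auto
  have I0: "?I \<ge> 0" by (intro integral_nonneg gint) (use g in auto)
  obtain f0 f1 where f: "\<And>t. F (\<i> * of_real t) = \<iota>\<^sub>0 (f0 t)" "\<And>t. F (1 + \<i> * of_real t) = \<iota>\<^sub>1 (f1 t)"
    by (rule interp_functions_boundary[OF F]) (rule that)
  have *: "interp_norm \<iota>\<^sub>0 \<iota>\<^sub>1 \<theta> (F (of_real \<theta>)) \<le> M * exp (- kappa \<theta> * ?I) * exp \<eta>" if \<eta>: "\<eta> > 0" for \<eta>
  proof -
    obtain \<epsilon> where \<epsilon>: "0 < \<epsilon>" "\<epsilon> \<le> 1"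
      "\<And>t. integral {-\<theta>..\<theta>} (\<lambda>s. g s * (\<epsilon> / (\<epsilon>\<^sup>2 + (t - s)\<^sup>2))) \<le> pi * g t + \<eta>"
      using poisson_approx[OF g \<theta>(1) \<eta>] by blast
    let ?\<phi> = "outer_exponent \<theta> g \<epsilon>"
    have Re: "Re (?\<phi> z) = integral {-\<theta>..\<theta>} (\<lambda>s. g s * Re (kern \<epsilon> (z - \<i> * of_real s)))"
      "(\<lambda>s. g s * Re (kern \<epsilon> (z - \<i> * of_real s))) integrable_on {-\<theta>..\<theta>}"
      if "0 \<le> Re z" "Re z \<le> 1" for z
      by (rule Re_outer_exponent[OF g(1)]; use that \<epsilon> in simp)+
    \<comment> \<open>Crude and dependent on \<epsilon>; it provides the bounded multiplier required
      for membership of the product in \<open>\<F>\<close>.\<close>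
    have bound: "Re (?\<phi> z) \<le> ?I * (1 / \<epsilon>)" if z: "0 \<le> Re z" "Re z \<le> 1" for z
    proof -
      have "Re (?\<phi> z) \<le> integral {-\<theta>..\<theta>} (\<lambda>s. g s * (1 / \<epsilon>))"
        unfolding Re(1)[OF z]
        by (intro integral_le Re(2)[OF z] integrable_on_mult_left gint mult_left_mono Re_kern_le_inverse)
          (use z \<epsilon> g in auto)
      then show ?thesis by simp
    qed
    have line0: "Re (?\<phi> (\<i> * of_real t)) \<le> pi * g t + \<eta>" for t
    proof -
      have "Re (?\<phi> (\<i> * of_real t)) \<le> integral {-\<theta>..\<theta>} (\<lambda>s. g s * (\<epsilon> / (\<epsilon>\<^sup>2 + (t - s)\<^sup>2)))"
      proof (subst Re(1), simp, simp, intro integral_le poisson_kernel_mult_integrable \<epsilon>(1) Re(2) mult_left_mono g)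
        show "Re (kern \<epsilon> (\<i> * of_real t - \<i> * of_real s)) \<le> \<epsilon> / (\<epsilon>\<^sup>2 + (t - s)\<^sup>2)" for s
          using Re_kern_le[OF \<epsilon>(1), of "\<i> * of_real t - \<i> * of_real s"] by simp
      qed simp_all
      then show ?thesis using \<epsilon>(3)[of t] by linarith
    qed
    have line1: "Re (?\<phi> (1 + \<i> * of_real t)) = 0" for t
      by (subst Re(1)) (simp_all add: Re_kern_eq_0)
    have at: "kappa \<theta> * ?I \<le> Re (?\<phi> (of_real \<theta>))"
    proof -
      have "integral {-\<theta>..\<theta>} (\<lambda>s. g s * kappa \<theta>) \<le> Re (?\<phi> (of_real \<theta>))"
      proof -
        have z: "0 \<le> Re (complex_of_real \<theta>)" "Re (complex_of_real \<theta>) \<le> 1" using \<theta> by simp_all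
        show ?thesis
          unfolding Re(1)[OF z]
        proof (intro integral_le Re(2)[OF z] integrable_on_mult_left gint mult_left_mono g)
          \<comment> \<open>The imaginary part is \<open>-s\<close>, of modulus at most \<theta>:
            this is the range of \<open>Re_kern_ge\<close> and dictates the interval of
            integration.\<close>
          show "kappa \<theta> \<le> Re (kern \<epsilon> (of_real \<theta> - \<i> * of_real s))" if "s \<in> {-\<theta>..\<theta>}" for s
            using that by (intro Re_kern_ge \<epsilon> \<theta>) auto
        qed
      qed
      then show ?thesis by (simp add: mult.commute)
    qed
    define m where "m z = exp (?\<phi> z - ?\<phi> (of_real \<theta>))" for z
    have m: "cmod (m z) = exp (Re (?\<phi> z) - Re (?\<phi> (of_real \<theta>)))" for z
      by (simp add: m_def)
    have G: "(\<lambda>z. m z *\<^sub>C F z) \<in> \<F>"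
    proof (rule interp_functions_scaleC[OF F _ open_convex_widened_strip(1)[of \<epsilon>]])
      show "m holomorphic_on {z. -\<epsilon> < Re z \<and> Re z < 2 + \<epsilon>}"
        unfolding m_def by (intro holomorphic_intros holomorphic_outer_exponent g(1))
      show "{z. 0 \<le> Re z \<and> Re z \<le> 1} \<subseteq> {z. -\<epsilon> < Re z \<and> Re z < 2 + \<epsilon>}" using \<epsilon> by auto
      show "cmod (m z) \<le> exp (?I * (1 / \<epsilon>) - Re (?\<phi> (of_real \<theta>)))" if "0 \<le> Re z" "Re z \<le> 1" for z
        using bound[OF that] by (simp add: m)
    qed
    let ?K = "M * exp (- kappa \<theta> * ?I) * exp \<eta>"
    have "interp_functions_norm \<iota>\<^sub>0 \<iota>\<^sub>1 (\<lambda>z. m z *\<^sub>C F z) \<le> ?K"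
    proof (rule interp_functions_norm_le)
      fix t
      have "cmod (m (\<i> * of_real t)) * norm (f0 t) \<le> exp (pi * g t + \<eta> - kappa \<theta> * ?I) * (M * exp (- pi * g t))"
        using line0[of t] at F0[of t] unfolding f embedded_norm0 by (intro mult_mono) (auto simp: m)
      also have "\<dots> = ?K" by (simp add: mult_exp_exp algebra_simps flip: exp_add exp_minus)
      finally show "embedded_norm \<iota>\<^sub>0 (m (\<i> * of_real t) *\<^sub>C F (\<i> * of_real t)) \<le> ?K"
        by (simp add: f embedded_norm_scaleC0)
      have "cmod (m (1 + \<i> * of_real t)) * norm (f1 t) \<le> exp (\<eta> - kappa \<theta> * ?I) * M"
        using at F1[of t] \<eta> unfolding f embedded_norm1 by (intro mult_mono) (auto simp: m line1)
      also have "\<dots> = ?K" by (simp add: mult_exp_exp algebra_simps flip: exp_add exp_minus)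
      finally show "embedded_norm \<iota>\<^sub>1 (m (1 + \<i> * of_real t) *\<^sub>C F (1 + \<i> * of_real t)) \<le> ?K"
        by (simp add: f embedded_norm_scaleC1)
    qed
    from interp_norm_le[OF G this, of \<theta>] show ?thesis by (simp add: m_def)
  qed
  \<comment> \<open>The choice of \<epsilon> depends on \<eta>, but the bound obtained does not
    involve \<epsilon>, so \<eta> may tend to zero.\<close>
  have "((\<lambda>\<eta>. M * exp (- kappa \<theta> * ?I) * exp \<eta>) \<longlongrightarrow> M * exp (- kappa \<theta> * ?I) * exp 0) (at_right 0)"
    by (intro tendsto_intros)
  then have "interp_norm \<iota>\<^sub>0 \<iota>\<^sub>1 \<theta> (F (of_real \<theta>)) \<le> M * exp (- kappa \<theta> * ?I) * exp 0"
  proof (rule tendsto_lowerbound)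
    show "\<forall>\<^sub>F \<eta> in at_right 0. interp_norm \<iota>\<^sub>0 \<iota>\<^sub>1 \<theta> (F (of_real \<theta>)) \<le> M * exp (- kappa \<theta> * ?I) * exp \<eta>"
      by (rule eventually_at_rightI[of 0 1]) (use * in simp_all)
  qed simp
  then show ?thesis by simp
qed

section \<open>Estimates for the sum and the difference of two functions of norm at most
  \<open>M\<close>\<close>

context
  fixes \<theta> M \<rho> :: real and F G f g
  assumes \<theta>: "0 < \<theta>" "\<theta> < 1" and M: "M > 0" and \<rho>: "\<rho> > 0"
    and FG: "F \<in> \<F>" "G \<in> \<F>"
      "interp_functions_norm \<iota>\<^sub>0 \<iota>\<^sub>1 F \<le> M" "interp_functions_norm \<iota>\<^sub>0 \<iota>\<^sub>1 G \<le> M"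
    and fg: "\<And>t. F (\<i> * of_real t) = \<iota>\<^sub>0 (f t)" "continuous_on UNIV f"
      "\<And>t. G (\<i> * of_real t) = \<iota>\<^sub>0 (g t)" "continuous_on UNIV g"
begin

lemma norm_boundary: "norm (f t) \<le> M" "norm (g t) \<le> M"
  using interp_functions_norm_ge(1)[OF FG(1), of t] interp_functions_norm_ge(1)[OF FG(2), of t] FG(3,4)
  by (simp_all add: fg embedded_norm0)

lemma norm_boundary1:
  "embedded_norm \<iota>\<^sub>1 (F (1 + \<i> * of_real t) + G (1 + \<i> * of_real t)) \<le> 2 * M"
  "embedded_norm \<iota>\<^sub>1 (F (1 + \<i> * of_real t) - G (1 + \<i> * of_real t)) \<le> 2 * M"
proof -
  obtain a where a: "\<And>t. F (1 + \<i> * of_real t) = \<iota>\<^sub>1 (a t)" by (rule interp_functions_boundary[OF FG(1)]) (rule that)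
  obtain b where b: "\<And>t. G (1 + \<i> * of_real t) = \<iota>\<^sub>1 (b t)" by (rule interp_functions_boundary[OF FG(2)]) (rule that)
  have "norm (a t) \<le> M" "norm (b t) \<le> M"
    using interp_functions_norm_ge(2)[OF FG(1), of t] interp_functions_norm_ge(2)[OF FG(2), of t] FG(3,4)
    by (simp_all add: a b embedded_norm1)
  then have "norm (a t + b t) \<le> 2 * M" "norm (a t - b t) \<le> 2 * M"
    using norm_triangle_ineq[of "a t" "b t"] norm_triangle_ineq4[of "a t" "b t"] by linarith+
  then show "embedded_norm \<iota>\<^sub>1 (F (1 + \<i> * of_real t) + G (1 + \<i> * of_real t)) \<le> 2 * M"
    "embedded_norm \<iota>\<^sub>1 (F (1 + \<i> * of_real t) - G (1 + \<i> * of_real t)) \<le> 2 * M"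
    by (simp_all add: a b embedded_norm1 flip: e1.add e1.diff)
qed

lemma deviation_bounds: "0 \<le> norm (f t - g t) / M" "norm (f t - g t) / M \<le> 2"
  using norm_triangle_ineq4[of "f t" "g t"] norm_boundary[of t] M by (auto simp: divide_le_eq)

text \<open>Where \<open>p t > 0\<close>, rotundity gives the factor
  \<open>1 - \<delta> / 2\<close>, at most \<open>exp (- \<delta> / 2)\<close>, and
  \<open>p t \<le> 2\<close> weakens it to \<open>exp (- \<delta> * p t / 4)\<close>. The weight is
  proportional to the excess \<open>p\<close>, not to an indicator function, because
  \<open>interp_norm_exp_le\<close> demands continuity.\<close>

lemma interp_norm_add_le:
  assumes \<delta>: "0 < \<delta>"
    "\<And>a b :: 'a. norm a \<le> 1 \<Longrightarrow> norm b \<le> 1 \<Longrightarrow> \<rho> \<le> norm (a - b) \<Longrightarrow> norm (a + b) \<le> 2 - \<delta>"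
  shows "interp_norm \<iota>\<^sub>0 \<iota>\<^sub>1 \<theta> (F (of_real \<theta>) + G (of_real \<theta>))
    \<le> 2 * M * exp (- kappa \<theta> * (\<delta> / (4 * pi) * integral {-\<theta>..\<theta>} (\<lambda>t. max 0 (norm (f t - g t) / M - \<rho>))))"
proof -
  define p where "p t = max 0 (norm (f t - g t) / M - \<rho>)" for t
  have p: "0 \<le> p t" "p t \<le> 2" for t using deviation_bounds[of t] \<rho> by (auto simp: p_def)
  have "norm (f t + g t) \<le> 2 * M * exp (- pi * (\<delta> / (4 * pi) * p t))" for t
  proof (cases "p t = 0")
    case True
    then show ?thesis using norm_triangle_ineq[of "f t" "g t"] norm_boundary[of t] by simp
  next
    case False
    then have "\<rho> \<le> norm (f t - g t) / M" by (auto simp: p_def max_def split: if_splits)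
    \<comment> \<open>Division by \<open>M\<close> brings both vectors into the unit ball, where
      \<delta> applies.\<close>
    then have "\<rho> \<le> norm (f t /\<^sub>R M - g t /\<^sub>R M)"
      using M by (simp add: divide_inverse mult.commute flip: scaleR_diff_right)
    then have "norm (f t /\<^sub>R M + g t /\<^sub>R M) \<le> 2 - \<delta>"
      using norm_boundary[of t] M by (intro \<delta>(2)) (simp_all add: divide_le_eq flip: divide_inverse_commute)
    then have "norm (f t + g t) / M \<le> 2 - \<delta>"
      using M by (simp add: divide_inverse mult.commute flip: scaleR_add_right)
    then have "norm (f t + g t) \<le> 2 * M * (1 + - \<delta> / 2)"
      using M unfolding pos_divide_le_eq[OF M] by (simp add: algebra_simps)
    also have "\<dots> \<le> 2 * M * exp (- \<delta> / 2)"
      using M exp_ge_add_one_self[of "- \<delta> / 2"] by (intro mult_left_mono) auto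
    also have "\<dots> \<le> 2 * M * exp (- pi * (\<delta> / (4 * pi) * p t))"
    proof -
      have "\<delta> * p t \<le> \<delta> * 2" using p[of t] \<delta>(1) by (intro mult_left_mono) auto
      then show ?thesis using M by (intro mult_left_mono) auto
    qed
    finally show ?thesis .
  qed
  moreover have "continuous_on UNIV p" unfolding p_def using fg M by (intro continuous_intros) auto
  ultimately have "interp_norm \<iota>\<^sub>0 \<iota>\<^sub>1 \<theta> (F (of_real \<theta>) + G (of_real \<theta>))
      \<le> 2 * M * exp (- kappa \<theta> * integral {-\<theta>..\<theta>} (\<lambda>t. \<delta> / (4 * pi) * p t))"
    using \<theta> M \<delta> p norm_boundary1
    by (intro interp_norm_exp_le[OF interp_functions_add[OF FG(1,2)]] continuous_intros)
       (auto simp: fg embedded_norm0 simp flip: e0.add)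
  then show ?thesis by (simp add: p_def)
qed

text \<open>The weight \<open>q\<close> solves
  \<open>2 * exp (- pi * q t) = max (d t) \<rho>\<close>: the floor \<rho> keeps the logarithm
  finite where \<open>d\<close> vanishes, and \<open>d t \<le> 2\<close> with
  \<open>\<rho> \<le> 2\<close> makes \<open>q\<close> nonnegative. The inequality
  \<open>ln u \<le> u - 1\<close> then bounds \<open>q\<close> below by a function affine in the
  excess of \<open>d\<close> over \<rho>.\<close>

lemma interp_norm_diff_le:
  assumes "\<rho> \<le> 2"
  shows "interp_norm \<iota>\<^sub>0 \<iota>\<^sub>1 \<theta> (F (of_real \<theta>) - G (of_real \<theta>))
    \<le> 2 * M * exp (- kappa \<theta> / pi * (2 * \<theta> * ln (2 / \<rho>)
         - integral {-\<theta>..\<theta>} (\<lambda>t. max 0 (norm (f t - g t) / M - \<rho>)) / \<rho>))"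
proof -
  define d where "d t = norm (f t - g t) / M" for t
  define q where "q t = ln (2 / max (d t) \<rho>) / pi" for t
  have d: "0 \<le> d t" "d t \<le> 2" for t using deviation_bounds[of t] by (auto simp: d_def)
  have mx: "0 < max (d t) \<rho>" "max (d t) \<rho> \<le> 2" for t using d[of t] \<rho> assms by auto
  have q0: "0 \<le> q t" for t using mx[of t] by (simp add: q_def)
  have cd: "continuous_on UNIV d" unfolding d_def using fg M by (intro continuous_intros) auto
  have cq: "continuous_on UNIV q" unfolding q_def
    using mx by (intro continuous_intros cd) (auto simp: less_imp_neq[THEN not_sym])
  have "norm (f t - g t) \<le> 2 * M * exp (- pi * q t)" for t
  proof -
    have "exp (- pi * q t) = max (d t) \<rho> / 2" using mx[of t] by (simp add: q_def exp_minus)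
    then have "2 * M * exp (- pi * q t) = M * max (d t) \<rho>" by simp
    moreover have "norm (f t - g t) = M * d t" using M by (simp add: d_def)
    ultimately show ?thesis using M by simp
  qed
  then have "interp_norm \<iota>\<^sub>0 \<iota>\<^sub>1 \<theta> (F (of_real \<theta>) - G (of_real \<theta>))
      \<le> 2 * M * exp (- kappa \<theta> * integral {-\<theta>..\<theta>} q)"
    using \<theta> M q0 cq norm_boundary1
    by (intro interp_norm_exp_le[OF interp_functions_diff[OF FG(1,2)]])
       (auto simp: fg embedded_norm0 simp flip: e0.diff)
  also have "\<dots> \<le> 2 * M * exp (- kappa \<theta> / pi * (2 * \<theta> * ln (2 / \<rho>) - integral {-\<theta>..\<theta>} (\<lambda>t. max 0 (d t - \<rho>)) / \<rho>))"
  proof -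
    let ?r = "\<lambda>t. (ln (2 / \<rho>) - max 0 (d t - \<rho>) / \<rho>) / pi"
    have int: "(\<lambda>t. max 0 (d t - \<rho>)) integrable_on {-\<theta>..\<theta>}" "q integrable_on {-\<theta>..\<theta>}"
      by (intro integrable_continuous_interval continuous_intros continuous_on_subset[OF cd] continuous_on_subset[OF cq]; simp)+
    have "?r t \<le> q t" for t
    proof -
      have "max (d t) \<rho> / \<rho> > 0" using mx[of t] \<rho> by simp
      then have "ln (max (d t) \<rho> / \<rho>) \<le> max (d t) \<rho> / \<rho> - 1" by (rule ln_le_minus_one)
      \<comment> \<open>The expression vanishes where \<open>d t \<le> \<rho>\<close>, so the
        correction is the very excess whose integral the sum estimate controls.\<close>
      also have "\<dots> = max 0 (d t - \<rho>) / \<rho>" using \<rho> by (auto simp: max_def field_simps)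
      finally have "ln (2 / \<rho>) - max 0 (d t - \<rho>) / \<rho> \<le> ln (2 / max (d t) \<rho>)"
        using mx[of t] \<rho> by (simp add: ln_div)
      then show ?thesis unfolding q_def by (intro divide_right_mono) auto
    qed
    then have "integral {-\<theta>..\<theta>} ?r \<le> integral {-\<theta>..\<theta>} q"
      using int by (intro integral_le integrable_on_divide integrable_diff) auto
    moreover have "integral {-\<theta>..\<theta>} ?r = (2 * \<theta> * ln (2 / \<rho>) - integral {-\<theta>..\<theta>} (\<lambda>t. max 0 (d t - \<rho>)) / \<rho>) / pi"
      using int(1) \<theta> by (subst integral_divide, subst integral_diff) (auto intro: integrable_on_divide)
    ultimately have "kappa \<theta> / pi * (2 * \<theta> * ln (2 / \<rho>) - integral {-\<theta>..\<theta>} (\<lambda>t. max 0 (d t - \<rho>)) / \<rho>)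
        \<le> kappa \<theta> * integral {-\<theta>..\<theta>} q"
      using mult_left_mono[of _ _ "kappa \<theta>"] kappa_pos[OF \<theta>] by fastforce
    then show ?thesis using M by (intro mult_left_mono) auto
  qed
  finally show ?thesis by (simp add: d_def)
qed

end

end

section \<open>Passage to sequences on the unit sphere of the interpolation space\<close>

theorem theorem5p3:
  fixes \<iota>\<^sub>0 :: "'a::complex_banach \<Rightarrow> 'v::complex_t2_tvs"
    and \<iota>\<^sub>1 :: "'b::complex_banach \<Rightarrow> 'v"
    and \<theta> :: real
  assumes "interpolation_couple \<iota>\<^sub>0 \<iota>\<^sub>1"
    and "0 < \<theta>" and "\<theta> < 1"
    and "uniformly_rotund (UNIV :: 'a set) norm"
  shows "uniformly_rotund (interp_space \<iota>\<^sub>0 \<iota>\<^sub>1 \<theta>) (interp_norm \<iota>\<^sub>0 \<iota>\<^sub>1 \<theta>)"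
  unfolding uniformly_rotund_def
proof (intro allI impI)
  interpret couple \<iota>\<^sub>0 \<iota>\<^sub>1 by standard (rule assms(1))
  let ?N = "interp_norm \<iota>\<^sub>0 \<iota>\<^sub>1 \<theta>"
  fix x y :: "nat \<Rightarrow> 'v"
  assume x: "\<forall>n. x n \<in> interp_space \<iota>\<^sub>0 \<iota>\<^sub>1 \<theta> \<and> ?N (x n) = 1"
    and y: "\<forall>n. y n \<in> interp_space \<iota>\<^sub>0 \<iota>\<^sub>1 \<theta> \<and> ?N (y n) = 1"
    and lim: "(\<lambda>n. ?N (x n + y n)) \<longlonglongrightarrow> 2"
  \<comment> \<open>Strictly above the norm \<open>1\<close>, so that functions of norm at most
    \<open>M n\<close> exist, yet tending to \<open>1\<close>.\<close>
  define M where "M n = 1 + inverse (real (Suc n))" for n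
  have M: "1 < M n" "M n \<le> 2" for n by (simp_all add: M_def field_simps)
  have M_lim: "M \<longlonglongrightarrow> 1"
    unfolding M_def using tendsto_add[OF tendsto_const LIMSEQ_inverse_real_of_nat, of 1] by simp
  have ex: "\<exists>F f. F \<in> \<F> \<and> F (of_real \<theta>) = v \<and> interp_functions_norm \<iota>\<^sub>0 \<iota>\<^sub>1 F \<le> M n \<and>
      (\<forall>t. F (\<i> * of_real t) = \<iota>\<^sub>0 (f t)) \<and> continuous_on UNIV f"
    if v: "v \<in> interp_space \<iota>\<^sub>0 \<iota>\<^sub>1 \<theta>" "?N v = 1" for v n
  proof -
    obtain F where F: "F \<in> \<F>" "F (of_real \<theta>) = v" "interp_functions_norm \<iota>\<^sub>0 \<iota>\<^sub>1 F < M n"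
      using interp_norm_approx[OF v(1), of "M n"] v(2) M(1)[of n] by auto
    obtain f where "\<And>t. F (\<i> * of_real t) = \<iota>\<^sub>0 (f t)" "continuous_on UNIV f"
      by (rule interp_functions_boundary[OF F(1)]) (rule that)
    then show ?thesis using F less_imp_le by blast
  qed
  have "\<forall>n. \<exists>F f. F \<in> \<F> \<and> F (of_real \<theta>) = x n \<and> interp_functions_norm \<iota>\<^sub>0 \<iota>\<^sub>1 F \<le> M n \<and>
      (\<forall>t. F (\<i> * of_real t) = \<iota>\<^sub>0 (f t)) \<and> continuous_on UNIV f"
    using ex x by blast
  then obtain F f where F: "\<And>n. F n \<in> \<F>" "\<And>n. F n (of_real \<theta>) = x n"
      "\<And>n. interp_functions_norm \<iota>\<^sub>0 \<iota>\<^sub>1 (F n) \<le> M n"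
      "\<And>n t. F n (\<i> * of_real t) = \<iota>\<^sub>0 (f n t)" "\<And>n. continuous_on UNIV (f n)"
    by metis
  have "\<forall>n. \<exists>F f. F \<in> \<F> \<and> F (of_real \<theta>) = y n \<and> interp_functions_norm \<iota>\<^sub>0 \<iota>\<^sub>1 F \<le> M n \<and>
      (\<forall>t. F (\<i> * of_real t) = \<iota>\<^sub>0 (f t)) \<and> continuous_on UNIV f"
    using ex y by blast
  then obtain G g where G: "\<And>n. G n \<in> \<F>" "\<And>n. G n (of_real \<theta>) = y n"
      "\<And>n. interp_functions_norm \<iota>\<^sub>0 \<iota>\<^sub>1 (G n) \<le> M n"
      "\<And>n t. G n (\<i> * of_real t) = \<iota>\<^sub>0 (g n t)" "\<And>n. continuous_on UNIV (g n)"
    by metis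
  define I where "I \<rho> n = integral {-\<theta>..\<theta>} (\<lambda>t. max 0 (norm (f n t - g n t) / M n - \<rho>))" for \<rho> n
  have M0: "0 < M n" for n using M(1)[of n] by simp
  have kappa: "kappa \<theta> > 0" by (rule kappa_pos[OF assms(2,3)])
  \<comment> \<open>Taking logarithms in the sum estimate bounds \<open>c * I \<rho> n\<close> by
    \<open>ln (2 * M n / ?N (x n + y n))\<close>, which tends to \<open>ln 1\<close>.\<close>
  have I_lim: "I \<rho> \<longlonglongrightarrow> 0" if \<rho>: "\<rho> > 0" for \<rho>
  proof -
    obtain \<delta> where \<delta>: "0 < \<delta>"
      "\<And>a b :: 'a. norm a \<le> 1 \<Longrightarrow> norm b \<le> 1 \<Longrightarrow> \<rho> \<le> norm (a - b) \<Longrightarrow> norm (a + b) \<le> 2 - \<delta>"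
      using uniformly_rotund_modulus[OF assms(4) \<rho>] by blast
    define c where "c = kappa \<theta> * (\<delta> / (4 * pi))"
    have c: "c > 0" using kappa \<delta>(1) by (simp add: c_def)
    have le: "?N (x n + y n) \<le> 2 * M n * exp (- (c * I \<rho> n))" for n
      using interp_norm_add_le[OF assms(2,3) M0 \<rho> F(1) G(1) F(3) G(3) F(4,5) G(4,5) \<delta>]
      by (simp add: F(2) G(2) I_def c_def mult.assoc)
    have pos: "0 \<le> I \<rho> n" for n
      unfolding I_def using F(5) G(5) M0[of n]
      by (intro integral_nonneg integrable_continuous_interval continuous_intros)
         (auto intro: continuous_on_subset)
    have "(\<lambda>n. ln (2 * M n / ?N (x n + y n))) \<longlonglongrightarrow> ln (2 * 1 / 2)"
      using M_lim lim by (intro tendsto_intros) auto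
    then have upper_lim: "(\<lambda>n. ln (2 * M n / ?N (x n + y n))) \<longlonglongrightarrow> 0" by simp
    \<comment> \<open>Holds only eventually: the limit \<open>2\<close> makes the norm of the sum
      positive from some index on, and it is then divided by.\<close>
    have upper: "\<forall>\<^sub>F n in sequentially. c * I \<rho> n \<le> ln (2 * M n / ?N (x n + y n))"
    proof (rule eventually_mono[OF order_tendstoD(1)[OF lim, of 0]])
      fix n assume N: "0 < ?N (x n + y n)"
      then have "exp (c * I \<rho> n) \<le> 2 * M n / ?N (x n + y n)"
        using le[of n] by (simp add: exp_minus field_simps)
      then show "c * I \<rho> n \<le> ln (2 * M n / ?N (x n + y n))"
        using N M0[of n] by (subst ln_ge_iff) auto
    qed simp
    have lower: "\<forall>\<^sub>F n in sequentially. 0 \<le> c * I \<rho> n"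
      using pos c by (intro always_eventually allI) simp
    have "(\<lambda>n. c * I \<rho> n) \<longlonglongrightarrow> 0"
      by (rule tendsto_sandwich[OF lower upper tendsto_const upper_lim])
    then show ?thesis using c tendsto_mult_left_iff[of c "I \<rho>" 0] by simp
  qed
  show "(\<lambda>n. ?N (x n - y n)) \<longlonglongrightarrow> 0"
  proof (rule order_tendstoI)
    fix e :: real assume "e < 0"
    moreover have "0 \<le> ?N (x n - y n)" for n
      using interp_norm_nonneg[OF interp_functions_diff[OF F(1) G(1)], of \<theta>] by (simp add: F(2) G(2))
    ultimately show "\<forall>\<^sub>F n in sequentially. e < ?N (x n - y n)"
      by (auto intro!: always_eventually simp: less_le_trans)
  next
    fix e :: real assume e: "0 < e"
    define k where "k = kappa \<theta> / pi"
    have k: "k > 0" using kappa by (simp add: k_def)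
    \<comment> \<open>Solved from \<open>k * (2 * \<theta> * L - 1) > ln (4 / e)\<close>: the
      \<open>1\<close> added to the absolute value makes the inequality strict, and
      \<open>max 0\<close> ensures \<open>\<rho> \<le> 2\<close> below.\<close>
    define L where "L = max 0 ((1 + (\<bar>ln (4 / e)\<bar> + 1) / k) / (2 * \<theta>))"
    \<comment> \<open>Inverts \<open>ln (2 / \<rho>) = L\<close>.\<close>
    define \<rho> where "\<rho> = 2 * exp (- L)"
    have "0 \<le> L" by (simp add: L_def)
    moreover have "2 / \<rho> = exp L" unfolding \<rho>_def exp_minus' by simp
    ultimately have \<rho>: "0 < \<rho>" "\<rho> \<le> 2" "ln (2 / \<rho>) = L" by (simp_all add: \<rho>_def)
    have "(1 + (\<bar>ln (4 / e)\<bar> + 1) / k) / (2 * \<theta>) \<le> L" by (simp add: L_def)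
    then have "(\<bar>ln (4 / e)\<bar> + 1) / k \<le> 2 * \<theta> * L - 1" using assms(2) by (simp add: pos_divide_le_eq mult.commute)
    then have "ln (4 / e) < k * (2 * \<theta> * L - 1)" using k by (simp add: pos_divide_le_eq mult.commute)
    then have "exp (- (k * (2 * \<theta> * L - 1))) < exp (- ln (4 / e))" by simp
    also have "\<dots> = e / 4" using e by (simp add: exp_minus)
    finally have small: "4 * exp (- (k * (2 * \<theta> * L - 1))) < e" by simp
    \<comment> \<open>As \<rho> is fixed before \<open>n\<close>, eventually
      \<open>I \<rho> n < \<rho>\<close>, and the correction \<open>I \<rho> n / \<rho>\<close> is
      at most the \<open>1\<close> subtracted in the choice of \<open>L\<close>. The factor
      \<open>4\<close> comes from \<open>M n \<le> 2\<close>.\<close>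
    show "\<forall>\<^sub>F n in sequentially. ?N (x n - y n) < e"
    proof (rule eventually_mono[OF order_tendstoD(2)[OF I_lim[OF \<rho>(1)] \<rho>(1)]])
      fix n assume "I \<rho> n < \<rho>"
      then have "I \<rho> n / \<rho> \<le> 1" using \<rho> by simp
      then have "k * (2 * \<theta> * L - 1) \<le> k * (2 * \<theta> * L - I \<rho> n / \<rho>)" using k by (intro mult_left_mono) auto
      moreover have "?N (x n - y n) \<le> 2 * M n * exp (- (k * (2 * \<theta> * L - I \<rho> n / \<rho>)))"
        using interp_norm_diff_le[OF assms(2,3) M0 \<rho>(1) F(1) G(1) F(3) G(3) F(4,5) G(4,5) \<rho>(2)]
        by (simp add: F(2) G(2) I_def k_def \<rho>(3))
      moreover have "2 * M n * exp (- (k * (2 * \<theta> * L - I \<rho> n / \<rho>))) \<le> 4 * exp (- (k * (2 * \<theta> * L - 1)))"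
        using M(2)[of n] calculation(1) by (intro mult_mono) auto
      ultimately show "?N (x n - y n) < e" using small by linarith
    qed
  qed
qed

end
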